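(* There exists an integer $n_0$ such that for all integers $n\ge n_0$ and all integers $s,t$ with $2\le s\le t\le \frac{\log n}{120\log\log n}$, \[ 2^{\frac{n}{32t}\log\left(\frac{2et}{s}\right)}\;\le\; g(n,s,t)\;\le\; 2^{\frac{4n}{t}\log\left(\frac{2et}{s}\right)}. \]
   Context: All logarithms are to base $2$, and $e$ is the base of the natural logarithm. $g(n,s,t)$ denotes the smallest integer $N$ such that every graph $G$ on $N$ vertices has a set $A$ of $n$ vertices which does not contain both a clique of size $s$ and an independent set of size $t$; that is, the induced subgraph $G[A]$ has no clique of size $s$, or $G[A]$ has no independent set of size $t$. *)

theory Defs
  imports Complex_Main "HOL-Library.Ramsey"
begin

definition has_clique :: "'a set \<Rightarrow> 'a set set \<Rightarrow> nat \<Rightarrow> bool"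
  where "has_clique A E s \<longleftrightarrow> (\<exists>K \<in> [A]\<^bsup>s\<^esup>. clique K E)"

definition has_indep :: "'a set \<Rightarrow> 'a set set \<Rightarrow> nat \<Rightarrow> bool"
  where "has_indep A E t \<longleftrightarrow> (\<exists>K \<in> [A]\<^bsup>t\<^esup>. indep K E)"

text \<open>
  Graphs are finite simple graphs: a finite vertex set together with a set of two-element
  subsets of it. Taking the vertices to be natural numbers loses no generality, as every
  finite graph is isomorphic to one of this form.
\<close>

definition all_graphs_have_good_set :: "nat \<Rightarrow> nat \<Rightarrow> nat \<Rightarrow> nat \<Rightarrow> bool"
  where "all_graphs_have_good_set N n s t \<longleftrightarrow>
    (\<forall>(V :: nat set) E. finite V \<longrightarrow> card V = N \<longrightarrow> E \<subseteq> [V]\<^bsup>2\<^esup> \<longrightarrow>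
      (\<exists>A \<in> [V]\<^bsup>n\<^esup>. \<not> (has_clique A E s \<and> has_indep A E t)))"

definition g :: "nat \<Rightarrow> nat \<Rightarrow> nat \<Rightarrow> nat"
  where "g n s t = (LEAST N. all_graphs_have_good_set N n s t)"

text \<open>The minimum defining \<open>g\<close> is taken over a nonempty set, by Ramsey's theorem.\<close>

lemma all_graphs_have_good_set_g:
  assumes "2 \<le> s" "2 \<le> t"
  shows "all_graphs_have_good_set (g n s t) n s t"
proof -
  obtain r where r: "\<And>(V :: nat set) E. \<lbrakk>finite V; card V \<ge> r\<rbrakk> \<Longrightarrow>
      \<exists>R \<subseteq> V. card R = n \<and> clique R E \<or> card R = n \<and> indep R E"
    using ramsey2[of n n, where 'a = nat] by blast
  have "all_graphs_have_good_set r n s t"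
    unfolding all_graphs_have_good_set_def
  proof (intro allI impI)
    fix V :: "nat set" and E
    assume V: "finite V" "card V = r"
    then obtain R where R: "R \<subseteq> V" "card R = n" "clique R E \<or> indep R E"
      using r[of V E] by auto
    have False if K: "K \<in> [R]\<^bsup>s\<^esup>" "clique K E" and L: "L \<in> [R]\<^bsup>t\<^esup>" "indep L E" for K L
    proof -
      have "\<exists>x\<in>M. \<exists>y\<in>M. x \<noteq> y" if "2 \<le> card M" for M :: "nat set"
        using that card_le_Suc0_iff_eq[of M] by (cases "finite M") force+
      moreover have "2 \<le> card K" "2 \<le> card L" "K \<subseteq> R" "L \<subseteq> R"
        using K L assms by (auto simp: nsets_def)
      ultimately obtain x y u v where
        "x \<in> K" "y \<in> K" "x \<noteq> y" "u \<in> L" "v \<in> L" "u \<noteq> v" by meson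
      with \<open>K \<subseteq> R\<close> \<open>L \<subseteq> R\<close> K L R(3) show False
        unfolding clique_def indep_def by blast
    qed
    moreover have "R \<in> [V]\<^bsup>n\<^esup>"
      using R V by (auto simp: nsets_def intro: finite_subset)
    ultimately show "\<exists>A \<in> [V]\<^bsup>n\<^esup>. \<not> (has_clique A E s \<and> has_indep A E t)"
      unfolding has_clique_def has_indep_def by blast
  qed
  then show ?thesis
    unfolding g_def by (rule LeastI)
qed

end

theory Submission
  imports Defs "HOL-Analysis.Harmonic_Numbers" "HOL-Real_Asymp.Real_Asymp"
begin

text \<open>
  Upper bound: by Erdos and Szekeres, cliques of size \<open>2n/t\<close> and independent sets of size \<open>2n/s\<close>
  can be removed repeatedly from a graph on \<open>N\<close> vertices, until there are \<open>t - 1\<close> cliques or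
  \<open>s - 1\<close> independent sets; their union is the required vertex set.

  Lower bound: in a random graph of density \<open>p = (s/t) powr (1/3) / 2\<close>, with positive
  probability every \<open>n\<close>-set contains both structures. The union bound over the \<open>n\<close>-sets needs
  the probability of having no \<open>s\<close>-clique in the form \<open>(1 - p) powr (n\<^sup>2 / (9 * s))\<close>, and
  symmetrically for independent \<open>t\<close>-sets with \<open>p\<close> for \<open>1 - p\<close>, up to a factor
  \<open>2 powr (n\<^sup>2 / l\<^sup>2)\<close> with \<open>l = log 2 n\<close>. This is a container theorem: every graph without
  \<open>t\<close>-clique lies in one of few graphs that miss \<open>n\<^sup>2 / (9 * t)\<close> pairs. As long as a container
  misses fewer pairs, it carries a probability distribution on its \<open>t\<close>-cliques in which every new
  vertex is spread over a constant fraction of all vertices, and the \<open>t\<close>-cliques are eliminated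
  vertex by vertex rather than edge by edge. All losses are then powers of \<open>l\<close> per vertex of the
  clique, and \<open>l ^ (11 * t) \<le> n powr (11 / 120)\<close> by the assumption on \<open>t\<close>.
\<close>

section \<open>Containers for cliques\<close>

text \<open>
  The complements of the sets in \<open>\<R>\<close> are containers: every set with property \<open>Q\<close> lies in one
  of at most \<open>m\<close> of them. Stating this for the complements keeps track of the number of
  elements that a container loses.
\<close>

definition avoidable :: "('a set \<Rightarrow> bool) \<Rightarrow> ('a set \<Rightarrow> bool) \<Rightarrow> nat \<Rightarrow> bool"
  where "avoidable Good Q m \<longleftrightarrow> (\<exists>\<R>. finite \<R> \<and> card \<R> \<le> m \<and> (\<forall>R\<in>\<R>. Good R) \<and>
    (\<forall>X. Q X \<longrightarrow> (\<exists>R\<in>\<R>. R \<inter> X = {})))"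

section \<open>Combining and counting families of containers\<close>

lemma avoidable_mono:
  assumes "avoidable Good Q m" "\<And>R. Good R \<Longrightarrow> Good' R" "\<And>X. Q' X \<Longrightarrow> Q X" "m \<le> m'"
  shows "avoidable Good' Q' m'"
  using assms unfolding avoidable_def by (meson order_trans)

lemma avoidable_empty: "(\<And>X. \<not> Q X) \<Longrightarrow> avoidable Good Q m"
  unfolding avoidable_def by (intro exI[of _ "{}"]) auto

lemma avoidable_single:
  "Good R \<Longrightarrow> (\<And>X. Q X \<Longrightarrow> R \<inter> X = {}) \<Longrightarrow> 1 \<le> m \<Longrightarrow> avoidable Good Q m"
  unfolding avoidable_def by (intro exI[of _ "{R}"]) auto

lemma avoidable_UN:
  assumes "finite I" "card I \<le> a"
    and av: "\<And>i. i \<in> I \<Longrightarrow> avoidable Good (Q' i) b"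
    and Q: "\<And>X. Q X \<Longrightarrow> \<exists>i\<in>I. Q' i X"
  shows "avoidable Good Q (a * b)"
proof -
  obtain \<R> where \<R>: "\<And>i. i \<in> I \<Longrightarrow> finite (\<R> i) \<and> card (\<R> i) \<le> b \<and> (\<forall>R\<in>\<R> i. Good R) \<and>
    (\<forall>X. Q' i X \<longrightarrow> (\<exists>R\<in>\<R> i. R \<inter> X = {}))"
    using av unfolding avoidable_def by metis
  have "card (\<Union>i\<in>I. \<R> i) \<le> (\<Sum>i\<in>I. card (\<R> i))"
    by (rule card_UN_le) fact
  also have "\<dots> \<le> card I * b"
    using sum_bounded_above[of I "\<lambda>i. card (\<R> i)" b] \<R> by (metis of_nat_id)
  also have "\<dots> \<le> a * b"
    using assms(2) by (rule mult_le_mono1)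
  finally have "card (\<Union>i\<in>I. \<R> i) \<le> a * b" .
  moreover have "\<exists>R\<in>(\<Union>i\<in>I. \<R> i). R \<inter> X = {}" if "Q X" for X
    using Q[OF that] \<R> by (meson UN_I)
  ultimately show ?thesis
    unfolding avoidable_def using \<R> assms(1) by (intro exI[of _ "\<Union>i\<in>I. \<R> i"]) blast
qed

text \<open>Each container is replaced by a second family that only has to serve the sets inside it.
  This allows repeated shrinking, at the price of multiplying the counts.\<close>

lemma avoidable_trans:
  assumes "avoidable Good Q m"
    and "\<And>R. Good R \<Longrightarrow> avoidable Good' (\<lambda>X. Q X \<and> R \<inter> X = {}) b"
  shows "avoidable Good' Q (m * b)"
proof -
  obtain \<R> where \<R>: "finite \<R>" "card \<R> \<le> m" "\<forall>R\<in>\<R>. Good R"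
    "\<forall>X. Q X \<longrightarrow> (\<exists>R\<in>\<R>. R \<inter> X = {})"
    using assms(1) unfolding avoidable_def by metis
  show ?thesis
  proof (rule avoidable_UN[of \<R> _ _ "\<lambda>R X. Q X \<and> R \<inter> X = {}"])
    show "avoidable Good' (\<lambda>X. Q X \<and> R \<inter> X = {}) b" if "R \<in> \<R>" for R
      using that \<R>(3) assms(2) by blast
  qed (use \<R> in blast)+
qed

text \<open>A set of size at most \<open>m + 1\<close> arises from one of size at most
  \<open>m\<close> by adding an element of \<open>U\<close> or nothing, the option
  \<open>None\<close>. This counts fingerprints.\<close>

lemma card_subsets_card_le:
  assumes "finite U"
  shows "card {D. D \<subseteq> U \<and> card D \<le> m} \<le> (card U + 1) ^ m"
proof (induction m)
  case 0
  have "{D. D \<subseteq> U \<and> card D \<le> 0} = {{}}"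
    using assms by (auto dest: finite_subset)
  then show ?case by simp
next
  case (Suc m)
  let ?P = "\<lambda>m. {D. D \<subseteq> U \<and> card D \<le> m}"
  let ?f = "\<lambda>(x, D). case x of None \<Rightarrow> D | Some u \<Rightarrow> insert u D"
  have "?P (Suc m) \<subseteq> ?f ` ((insert None (Some ` U)) \<times> ?P m)"
  proof
    fix D assume D: "D \<in> ?P (Suc m)"
    show "D \<in> ?f ` ((insert None (Some ` U)) \<times> ?P m)"
    proof (cases "D = {}")
      case True
      then show ?thesis by (intro image_eqI[of _ _ "(None, {})"]) auto
    next
      case False
      then obtain u where u: "u \<in> D" by blast
      have "card (D - {u}) \<le> m"
        using D u by (auto simp: card_Diff_singleton)
      then show ?thesis
        using D u by (intro image_eqI[of _ _ "(Some u, D - {u})"]) auto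
    qed
  qed
  moreover have fin: "finite ((insert None (Some ` U)) \<times> ?P m)"
    using assms by (auto intro!: finite_cartesian_product finite_subset[of "?P m" "Pow U"])
  ultimately have "card (?P (Suc m)) \<le> card ((insert None (Some ` U)) \<times> ?P m)"
    by (rule surj_card_le[rotated])
  also have "\<dots> = (card U + 1) * card (?P m)"
    using assms by (simp add: card_cartesian_product card_image)
  also have "\<dots> \<le> (card U + 1) * (card U + 1) ^ m"
    using Suc by (rule mult_le_mono2)
  finally show ?case by simp
qed

section \<open>Tuples and spread weights\<close>

definition tuples :: "'a set \<Rightarrow> nat \<Rightarrow> 'a list set"
  where "tuples V k = {y. set y \<subseteq> V \<and> length y = k}"

lemma finite_tuples: "finite V \<Longrightarrow> finite (tuples V k)"
  unfolding tuples_def by (rule finite_lists_length_eq)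

lemma card_tuples: "finite V \<Longrightarrow> card (tuples V k) = card V ^ k"
  unfolding tuples_def by (rule card_lists_length_eq)

lemma tuples_0: "tuples V 0 = {[]}"
  by (auto simp: tuples_def)

lemma Cons_in_tuples: "x # y \<in> tuples V (Suc k) \<longleftrightarrow> x \<in> V \<and> y \<in> tuples V k"
  by (auto simp: tuples_def)

lemma tuples_mono: "N \<subseteq> V \<Longrightarrow> tuples N k \<subseteq> tuples V k"
  by (auto simp: tuples_def)

lemma sum_tuples_Suc:
  "(\<Sum>z\<in>tuples V (Suc k). f z) = (\<Sum>y\<in>tuples V k. \<Sum>x\<in>V. f (x # y))"
proof -
  have "bij_betw (\<lambda>(y, x). x # y) (tuples V k \<times> V) (tuples V (Suc k))"
    by (intro bij_betwI[of _ _ _ "\<lambda>z. (tl z, hd z)"]) (auto simp: tuples_def length_Suc_conv)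
  then have "(\<Sum>z\<in>tuples V (Suc k). f z) = (\<Sum>(y, x)\<in>tuples V k \<times> V. f (x # y))"
    by (simp add: sum.reindex_bij_betw[symmetric] case_prod_beta)
  then show ?thesis
    by (simp add: sum.cartesian_product)
qed

text \<open>Stands in for a greedy algorithm: a maximal set is a state that admits no further
  step.\<close>

lemma ex_maximal_subset:
  assumes "finite N" "P {}"
  shows "\<exists>S\<subseteq>N. P S \<and> (\<forall>x\<in>N - S. \<not> P (insert x S))"
proof -
  have "finite {S. S \<subseteq> N \<and> P S}" "{S. S \<subseteq> N \<and> P S} \<noteq> {}"
    using assms by auto
  from finite_has_maximal[OF this] obtain S where
    S: "S \<subseteq> N" "P S" and max: "\<forall>T\<in>{S. S \<subseteq> N \<and> P S}. S \<subseteq> T \<longrightarrow> S = T"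
    by auto
  have "\<not> P (insert x S)" if "x \<in> N - S" for x
    using max[rule_format, of "insert x S"] that S(1) by auto
  with S show ?thesis by blast
qed

text \<open>
  A tuple is built by adding vertices in front, so the tail of a list is the part that was chosen
  earlier, and \<open>wt\<close> on \<open>k\<close>-tuples dominates the marginal of \<open>wt\<close> on \<open>(k + 1)\<close>-tuples.
\<close>

locale spread_weight =
  fixes V :: "'a set" and \<kappa> :: real and wt :: "'a list \<Rightarrow> real"
  assumes fin: "finite V" and V_ne: "V \<noteq> {}"
    and \<kappa>: "1 \<le> \<kappa>"
    and wt_nonneg: "0 \<le> wt y"
    and wt_Nil: "wt [] = 1"
    and wt_Cons_le: "\<lbrakk>x \<in> V; y \<in> tuples V k\<rbrakk> \<Longrightarrow> wt (x # y) \<le> \<kappa> / card V * wt y"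
    and sum_wt_Cons_le: "y \<in> tuples V k \<Longrightarrow> (\<Sum>x\<in>V. wt (x # y)) \<le> wt y"
begin

lemma card_V_pos: "0 < real (card V)"
  using fin V_ne by (simp add: card_gt_0_iff)

lemma wt_le_power: "y \<in> tuples V k \<Longrightarrow> wt y \<le> (\<kappa> / card V) ^ k"
proof (induction k arbitrary: y)
  case 0
  then show ?case by (simp add: tuples_0 wt_Nil)
next
  case (Suc k)
  then obtain x z where y: "y = x # z" "x \<in> V" "z \<in> tuples V k"
    by (cases y) (auto simp: tuples_def)
  have "wt y \<le> \<kappa> / card V * wt z"
    using y wt_Cons_le by simp
  also have "\<dots> \<le> \<kappa> / card V * (\<kappa> / card V) ^ k"
    using Suc.IH[OF y(3)] \<kappa> by (intro mult_left_mono) auto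
  finally show ?case by simp
qed

lemma sum_wt_le_1: "(\<Sum>y\<in>tuples V k. wt y) \<le> 1"
proof (induction k)
  case 0
  then show ?case by (simp add: tuples_0 wt_Nil)
next
  case (Suc k)
  have "(\<Sum>y\<in>tuples V (Suc k). wt y) \<le> (\<Sum>y\<in>tuples V k. wt y)"
    unfolding sum_tuples_Suc by (intro sum_mono sum_wt_Cons_le)
  with Suc show ?case by simp
qed

text \<open>
  A Kleitman--Winston argument. A prefix \<open>y\<close> is saturated by \<open>S\<close> if at least the fraction \<open>\<alpha>\<close> of
  its weight extends into \<open>S\<close>. Take \<open>S \<subseteq> N\<close> maximal such that each element of \<open>S\<close> has
  accounted for weight \<open>\<theta> / card V\<close> on unsaturated prefixes. Then \<open>S\<close> is small, and the
  vertices outside \<open>S\<close> that still carry so much unsaturated weight form a set which is determined by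
  \<open>S\<close> alone and avoids \<open>N\<close>. If this set is small, most of the weight lies on saturated prefixes,
  and the induction hypothesis applies to them: each level costs \<open>N\<close> only a factor \<open>\<alpha>\<close>.
\<close>

lemma light_sets_avoidable:
  fixes \<alpha> \<beta> \<theta> :: real and L :: nat
  assumes \<alpha>: "0 < \<alpha>" and \<theta>: "0 < \<theta>" and L: "2 * \<alpha> * \<kappa> * card V / \<theta> \<le> L"
    and "\<kappa> ^ k \<le> \<alpha> * card V"
    and "\<And>y. y \<in> tuples V k \<Longrightarrow> 0 \<le> w y \<and> w y \<le> \<kappa> * wt y"
    and "\<beta> + k * (2 * \<theta> + \<alpha> * \<kappa>) \<le> (\<Sum>y\<in>tuples V k. w y)"
  shows "avoidable
    (\<lambda>R. R \<subseteq> V \<and> \<theta> * card V / \<kappa>\<^sup>2 \<le> card R \<and> (\<forall>x\<in>R. \<exists>y\<in>tuples V k. x \<in> set y \<and> 0 < w y))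
    (\<lambda>N. N \<subseteq> V \<and> (\<Sum>y\<in>tuples N k. w y) < \<alpha> ^ k * \<beta>) ((card V + 1) ^ (L * k))"
  using assms(4-)
proof (induction k arbitrary: w)
  case 0
  then show ?case by (intro avoidable_empty) (auto simp: tuples_0)
next
  case (Suc k)
  let ?n = "real (card V)" and ?T = "tuples V k"
  note finT = finite_tuples[OF fin, of k]
  note n0 = card_V_pos
  define \<delta> where "\<delta> = \<kappa> * (\<kappa> / ?n) ^ Suc k"
  define wb where "wb y = (\<Sum>x\<in>V. w (x # y))" for y
  define cov where "cov S y = (\<Sum>x\<in>S. w (x # y))" for S y
  define unsat where "unsat S = {y \<in> ?T. cov S y < \<alpha> * wb y}" for S
  define rej where "rej S = {x \<in> V - S. \<theta> / ?n \<le> (\<Sum>y\<in>unsat S. w (x # y))}" for S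
  define w' where "w' S y = (if y \<in> unsat S then 0 else wb y)" for S y
  \<comment> \<open>Since \<delta> bounds every single \<open>w (x # y)\<close>, the cap does not
    bite when a vertex is added over an unsaturated prefix, so \<Phi> grows by the full weight.
    Still the cap keeps \<Phi> at most \<open>2 * \<alpha> * \<kappa>\<close>.\<close>
  define \<Phi> where "\<Phi> S = (\<Sum>y\<in>?T. min (cov S y) (\<alpha> * wb y + \<delta>))" for S

  have w: "0 \<le> w (x # y)" "w (x # y) \<le> \<kappa> * wt (x # y)" if "x \<in> V" "y \<in> ?T" for x y
    using Suc.prems(2)[of "x # y"] that by (auto simp: Cons_in_tuples)
  have w2: "w (x # y) \<le> \<kappa>\<^sup>2 / ?n * wt y" if "x \<in> V" "y \<in> ?T" for x y
  proof -
    have "\<kappa> * wt (x # y) \<le> \<kappa> * (\<kappa> / ?n * wt y)"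
      using wt_Cons_le[OF that] \<kappa> by (intro mult_left_mono) auto
    then show ?thesis using w[OF that] by (simp add: power2_eq_square)
  qed
  have w3: "w (x # y) \<le> \<delta>" if "x \<in> V" "y \<in> ?T" for x y
  proof -
    have "\<kappa> * wt (x # y) \<le> \<delta>"
      unfolding \<delta>_def using that \<kappa> by (intro mult_left_mono wt_le_power) (auto simp: Cons_in_tuples)
    then show ?thesis using w[OF that] by simp
  qed
  have wb: "0 \<le> wb y" "wb y \<le> \<kappa> * wt y" if "y \<in> ?T" for y
  proof -
    show "0 \<le> wb y"
      unfolding wb_def using w that by (intro sum_nonneg) auto
    have "wb y \<le> (\<Sum>x\<in>V. \<kappa> * wt (x # y))"
      unfolding wb_def using w that by (intro sum_mono) auto
    also have "\<dots> \<le> \<kappa> * wt y"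
      unfolding sum_distrib_left[symmetric] using \<kappa> sum_wt_Cons_le[OF that]
      by (intro mult_left_mono) auto
    finally show "wb y \<le> \<kappa> * wt y" .
  qed
  have sum_wb: "(\<Sum>y\<in>?T. wb y) \<le> \<kappa>"
  proof -
    have "(\<Sum>y\<in>?T. wb y) \<le> (\<Sum>y\<in>?T. \<kappa> * wt y)"
      using wb by (intro sum_mono) auto
    also have "\<dots> \<le> \<kappa> * 1"
      unfolding sum_distrib_left[symmetric] using \<kappa> sum_wt_le_1 by (intro mult_left_mono) auto
    finally show ?thesis by simp
  qed
  have cov_nonneg: "0 \<le> cov S y" if "S \<subseteq> V" "y \<in> ?T" for S y
    unfolding cov_def using w that by (intro sum_nonneg) auto
  have \<Phi>_le: "\<Phi> S \<le> 2 * \<alpha> * \<kappa>" for S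
  proof -
    have "\<Phi> S \<le> (\<Sum>y\<in>?T. \<alpha> * wb y + \<delta>)"
      unfolding \<Phi>_def by (intro sum_mono) auto
    also have "\<dots> = \<alpha> * (\<Sum>y\<in>?T. wb y) + ?n ^ k * \<delta>"
      by (simp add: sum.distrib sum_distrib_left card_tuples fin)
    \<comment> \<open>The hypothesis on \<open>\<kappa> ^ Suc k\<close> keeps the sum of the slack
      \<delta> over all prefixes below \<open>\<alpha> * \<kappa>\<close>.\<close>
    also have "?n ^ k * \<delta> = \<kappa> * \<kappa> ^ Suc k / ?n"
      unfolding \<delta>_def using n0 by (simp add: power_divide field_simps)
    also have "\<dots> \<le> \<kappa> * (\<alpha> * ?n) / ?n"
      using Suc.prems(1) \<kappa> n0 by (intro divide_right_mono mult_left_mono) auto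
    also have "\<dots> = \<alpha> * \<kappa>"
      using n0 by simp
    also have "\<alpha> * (\<Sum>y\<in>?T. wb y) \<le> \<alpha> * \<kappa>"
      using \<alpha> sum_wb by simp
    finally show ?thesis by simp
  qed
  have \<Phi>_insert: "\<Phi> S + (\<Sum>y\<in>unsat S. w (x # y)) \<le> \<Phi> (insert x S)"
    if "S \<subseteq> V" "x \<in> V - S" for S x
  proof -
    have fS: "finite S" using that fin finite_subset by auto
    have "(\<Sum>y\<in>unsat S. w (x # y)) = (\<Sum>y\<in>?T. if y \<in> unsat S then w (x # y) else 0)"
      using finT by (subst sum.If_cases) (auto simp: unsat_def intro!: sum.cong)
    then have "\<Phi> S + (\<Sum>y\<in>unsat S. w (x # y)) =
      (\<Sum>y\<in>?T. min (cov S y) (\<alpha> * wb y + \<delta>) + (if y \<in> unsat S then w (x # y) else 0))"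
      by (simp add: \<Phi>_def sum.distrib)
    also have "\<dots> \<le> (\<Sum>y\<in>?T. min (cov (insert x S) y) (\<alpha> * wb y + \<delta>))"
    proof (rule sum_mono)
      fix y assume y: "y \<in> ?T"
      have "cov (insert x S) y = cov S y + w (x # y)"
        unfolding cov_def using fS that by simp
      then show "min (cov S y) (\<alpha> * wb y + \<delta>) + (if y \<in> unsat S then w (x # y) else 0)
          \<le> min (cov (insert x S) y) (\<alpha> * wb y + \<delta>)"
        using w(1)[of x y] w3[of x y] that y by (auto simp: unsat_def)
    qed
    finally show ?thesis by (simp add: \<Phi>_def)
  qed

  let ?Good = "\<lambda>R. R \<subseteq> V \<and> \<theta> * ?n / \<kappa>\<^sup>2 \<le> card R \<and>
    (\<forall>x\<in>R. \<exists>y\<in>tuples V (Suc k). x \<in> set y \<and> 0 < w y)"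
  let ?Q = "\<lambda>N. N \<subseteq> V \<and> (\<Sum>y\<in>tuples N (Suc k). w y) < \<alpha> ^ Suc k * \<beta>"
  let ?Q' = "\<lambda>S N. ?Q N \<and> S \<subseteq> N \<and> rej S \<inter> N = {}"
  have "avoidable ?Good ?Q ((card V + 1) ^ L * (card V + 1) ^ (L * k))"
  proof (rule avoidable_UN[where I = "{S. S \<subseteq> V \<and> card S \<le> L}" and Q' = ?Q'])
    show "finite {S. S \<subseteq> V \<and> card S \<le> L}"
      using fin by simp
    show "card {S. S \<subseteq> V \<and> card S \<le> L} \<le> (card V + 1) ^ L"
      using fin by (rule card_subsets_card_le)
  next
    fix N assume N: "?Q N"
    then have fN: "finite N" using fin finite_subset by auto
    obtain S where S: "S \<subseteq> N" "card S * (\<theta> / ?n) \<le> \<Phi> S"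
      "\<And>x. x \<in> N - S \<Longrightarrow> \<not> card (insert x S) * (\<theta> / ?n) \<le> \<Phi> (insert x S)"
    proof -
      have "card {} * (\<theta> / ?n) \<le> \<Phi> {}"
        unfolding \<Phi>_def cov_def using wb(1) \<alpha> \<kappa>
        by (auto intro!: sum_nonneg add_nonneg_nonneg simp: \<delta>_def)
      from ex_maximal_subset[of N "\<lambda>S. card S * (\<theta> / ?n) \<le> \<Phi> S", OF fN this]
      show ?thesis using that by blast
    qed
    have SV: "S \<subseteq> V" and fS: "finite S" using S N fN finite_subset by auto
    have "card S * (\<theta> / ?n) \<le> 2 * \<alpha> * \<kappa>"
      using S(2) \<Phi>_le[of S] by linarith
    then have "card S \<le> 2 * \<alpha> * \<kappa> * ?n / \<theta>"
      using n0 \<theta> by (simp add: field_simps)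
    then have "card S \<le> L"
      using L by linarith
    \<comment> \<open>By \<open>\<Phi>_insert\<close>, a rejected vertex of \<open>N\<close> could
      be added to \<open>S\<close>, against maximality.\<close>
    moreover have "rej S \<inter> N = {}"
    proof -
      have False if x: "x \<in> rej S" "x \<in> N" for x
      proof -
        have x': "x \<in> N - S" "x \<in> V - S" using x by (auto simp: rej_def)
        have "card (insert x S) * (\<theta> / ?n) = card S * (\<theta> / ?n) + \<theta> / ?n"
          using x' fS by (simp add: distrib_right add_divide_distrib)
        then show False
          using \<Phi>_insert[OF SV x'(2)] S(2) S(3)[OF x'(1)] x(1) by (simp add: rej_def)
      qed
      then show ?thesis by blast
    qed
    ultimately show "\<exists>S\<in>{S. S \<subseteq> V \<and> card S \<le> L}. ?Q' S N"
      using S(1) SV N by blast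
  next
    fix S assume "S \<in> {S. S \<subseteq> V \<and> card S \<le> L}"
    then have SV: "S \<subseteq> V" and fS: "finite S" using fin finite_subset by auto
    have unT: "unsat S \<subseteq> ?T" by (auto simp: unsat_def)
    show "avoidable ?Good (?Q' S) ((card V + 1) ^ (L * k))"
    proof (cases "\<theta> * ?n / \<kappa>\<^sup>2 \<le> card (rej S)")
      case True
      have "\<exists>y\<in>tuples V (Suc k). x \<in> set y \<and> 0 < w y" if x: "x \<in> rej S" for x
      proof -
        have "0 < \<theta> / ?n" "\<theta> / ?n \<le> (\<Sum>y\<in>unsat S. w (x # y))"
          using x \<theta> n0 by (auto simp: rej_def)
        then have "0 < (\<Sum>y\<in>unsat S. w (x # y))" by linarith
        then obtain y where "y \<in> unsat S" "0 < w (x # y)"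
          by (meson not_le sum_nonpos)
        then show ?thesis
          using x unT by (intro bexI[of _ "x # y"]) (auto simp: Cons_in_tuples rej_def)
      qed
      with True have "?Good (rej S)" by (auto simp: rej_def)
      then show ?thesis by (rule avoidable_single) auto
    next
      case False
      have rejV: "rej S \<subseteq> V" by (auto simp: rej_def)
      have finrej: "finite (rej S)" using rejV fin finite_subset by auto
      \<comment> \<open>Unsaturated weight is split by its front vertex: \<open>S\<close> covers at
        most the fraction \<alpha> of it; the few vertices of \<open>rej S\<close> carry at most
        \<open>\<kappa>\<^sup>2 / ?n\<close> each, in total at most \<theta>; all others carry less
        than \<open>\<theta> / ?n\<close> each, again at most \<theta>.\<close>
      have "(\<Sum>y\<in>unsat S. wb y) = (\<Sum>x\<in>V. \<Sum>y\<in>unsat S. w (x # y))"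
        unfolding wb_def by (rule sum.swap)
      also have "\<dots> = (\<Sum>x\<in>S \<union> rej S \<union> (V - S - rej S). \<Sum>y\<in>unsat S. w (x # y))"
        using SV rejV by (intro sum.cong) auto
      also have "\<dots> = (\<Sum>x\<in>S. \<Sum>y\<in>unsat S. w (x # y)) + (\<Sum>x\<in>rej S. \<Sum>y\<in>unsat S. w (x # y))
          + (\<Sum>x\<in>V - S - rej S. \<Sum>y\<in>unsat S. w (x # y))"
        using fin fS finrej
        by (subst sum.union_disjoint; (subst sum.union_disjoint)?) (auto simp: rej_def)
      also have "(\<Sum>x\<in>S. \<Sum>y\<in>unsat S. w (x # y)) = (\<Sum>y\<in>unsat S. cov S y)"
        unfolding cov_def by (rule sum.swap)
      also have "\<dots> \<le> (\<Sum>y\<in>unsat S. \<alpha> * wb y)"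
        by (intro sum_mono) (auto simp: unsat_def)
      also have "\<dots> \<le> (\<Sum>y\<in>?T. \<alpha> * wb y)"
        using unT finT wb \<alpha> by (intro sum_mono2) auto
      also have "\<dots> \<le> \<alpha> * \<kappa>"
        unfolding sum_distrib_left[symmetric] using \<alpha> sum_wb by simp
      also have "(\<Sum>x\<in>rej S. \<Sum>y\<in>unsat S. w (x # y)) \<le> (\<Sum>x\<in>rej S. \<kappa>\<^sup>2 / ?n)"
      proof (rule sum_mono)
        fix x assume x: "x \<in> rej S"
        have "(\<Sum>y\<in>unsat S. w (x # y)) \<le> (\<Sum>y\<in>?T. w (x # y))"
          using x rejV unT finT w by (intro sum_mono2) auto
        also have "\<dots> \<le> (\<Sum>y\<in>?T. \<kappa>\<^sup>2 / ?n * wt y)"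
          using w2 x rejV by (intro sum_mono) auto
        also have "\<dots> \<le> \<kappa>\<^sup>2 / ?n * 1"
          unfolding sum_distrib_left[symmetric] using sum_wt_le_1 by (intro mult_left_mono) auto
        finally show "(\<Sum>y\<in>unsat S. w (x # y)) \<le> \<kappa>\<^sup>2 / ?n" by simp
      qed
      also have "\<dots> \<le> \<theta>"
        using False n0 \<kappa> by (simp add: field_simps)
      also have "(\<Sum>x\<in>V - S - rej S. \<Sum>y\<in>unsat S. w (x # y)) \<le> (\<Sum>x\<in>V - S - rej S. \<theta> / ?n)"
        by (intro sum_mono) (auto simp: rej_def)
      also have "\<dots> \<le> (\<Sum>x\<in>V. \<theta> / ?n)"
        using fin \<theta> n0 by (intro sum_mono2) auto
      also have "\<dots> = \<theta>"
        using n0 by simp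
      finally have un_mass: "(\<Sum>y\<in>unsat S. wb y) \<le> 2 * \<theta> + \<alpha> * \<kappa>" by simp
      have "(\<Sum>y\<in>?T. w' S y) + (\<Sum>y\<in>unsat S. wb y) = (\<Sum>y\<in>?T. wb y)"
      proof -
        have "(\<Sum>y\<in>unsat S. wb y) = (\<Sum>y\<in>?T. if y \<in> unsat S then wb y else 0)"
          using finT by (subst sum.If_cases) (auto simp: unsat_def intro!: sum.cong)
        then show ?thesis
          unfolding w'_def by (simp flip: sum.distrib) (intro sum.cong; simp)
      qed
      moreover have "\<beta> + Suc k * (2 * \<theta> + \<alpha> * \<kappa>) \<le> (\<Sum>y\<in>?T. wb y)"
        using Suc.prems(3) unfolding wb_def sum_tuples_Suc .
      ultimately have mass: "\<beta> + k * (2 * \<theta> + \<alpha> * \<kappa>) \<le> (\<Sum>y\<in>?T. w' S y)"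
        using un_mass by (simp add: algebra_simps)
      have w'_le: "0 \<le> w' S y \<and> w' S y \<le> \<kappa> * wt y" if "y \<in> ?T" for y
        using wb[OF that] \<kappa> wt_nonneg[of y] by (auto simp: w'_def)
      have "\<kappa> ^ k \<le> \<kappa> ^ Suc k"
        using \<kappa> by (intro power_increasing) auto
      then have "\<kappa> ^ k \<le> \<alpha> * ?n"
        using Suc.prems(1) by linarith
      note IH = Suc.IH[of "w' S", OF this w'_le mass]
      from IH show ?thesis
      proof (rule avoidable_mono)
        fix R assume R: "R \<subseteq> V \<and> \<theta> * ?n / \<kappa>\<^sup>2 \<le> card R \<and>
          (\<forall>x\<in>R. \<exists>y\<in>?T. x \<in> set y \<and> 0 < w' S y)"
        have "\<exists>y\<in>tuples V (Suc k). x \<in> set y \<and> 0 < w y" if "x \<in> R" for x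
        proof -
          from R that have "\<exists>y\<in>?T. x \<in> set y \<and> 0 < w' S y" by (elim conjE) (erule bspec)
          then obtain y where y: "y \<in> ?T" "x \<in> set y" "0 < w' S y" by (elim bexE conjE)
          then have "0 < (\<Sum>z\<in>V. w (z # y))" by (simp add: w'_def wb_def split: if_splits)
          then obtain z where "z \<in> V" "0 < w (z # y)"
            by (meson not_le sum_nonpos)
          then show ?thesis
            using y by (intro bexI[of _ "z # y"]) (auto simp: Cons_in_tuples)
        qed
        with R show "?Good R" by blast
      next
        fix N assume N: "?Q' S N"
        then have NV: "N \<subseteq> V" and SN: "S \<subseteq> N" by auto
        have fN: "finite N" using NV fin finite_subset by auto
        have TN: "y \<in> ?T" if "y \<in> tuples N k" for y
          using that NV tuples_mono by blast
        \<comment> \<open>\<open>w'\<close> vanishes on unsaturated prefixes, and over the others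
          \<open>S\<close>, a part of \<open>N\<close>, already supplies the fraction \<alpha> of
          the weight.\<close>
        have "\<alpha> * (\<Sum>y\<in>tuples N k. w' S y) \<le> (\<Sum>y\<in>tuples N k. cov S y)"
          unfolding sum_distrib_left using TN cov_nonneg[OF SV]
          by (intro sum_mono) (auto simp: w'_def unsat_def)
        also have "\<dots> \<le> (\<Sum>y\<in>tuples N k. \<Sum>x\<in>N. w (x # y))"
          unfolding cov_def using SN fN NV TN w by (intro sum_mono sum_mono2) auto
        also have "\<dots> < \<alpha> ^ Suc k * \<beta>"
          using N unfolding sum_tuples_Suc by blast
        finally have "(\<Sum>y\<in>tuples N k. w' S y) < \<alpha> ^ k * \<beta>"
          using \<alpha> by simp
        with NV show "N \<subseteq> V \<and> (\<Sum>y\<in>tuples N k. w' S y) < \<alpha> ^ k * \<beta>" by blast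
      qed (assumption | rule order_refl)+
    qed
  qed
  then show ?case
    by (simp add: power_add)
qed

end

section \<open>Eliminating the vertices of a clique one by one\<close>

fun list_clique :: "'a set set \<Rightarrow> 'a list \<Rightarrow> bool"
  where
    "list_clique H [] \<longleftrightarrow> True"
  | "list_clique H (x # y) \<longleftrightarrow> (\<forall>u\<in>set y. {x, u} \<in> H) \<and> list_clique H y"

text \<open>An unordered pair is hit at most twice, once in each order.\<close>

lemma card_Sigma_le_twice_pairs:
  assumes "finite A" "\<And>v. v \<in> A \<Longrightarrow> finite (f v)"
  shows "card (Sigma A f) \<le> 2 * card {{v, x} | v x. v \<in> A \<and> x \<in> f v}"
proof -
  let ?R = "{{v, x} | v x. v \<in> A \<and> x \<in> f v}"
  have R: "?R = (\<lambda>(v, x). {v, x}) ` Sigma A f" by auto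
  have fin: "finite (Sigma A f)" using assms by auto
  have "Sigma A f = (\<Union>e\<in>?R. {p \<in> Sigma A f. {fst p, snd p} = e})" unfolding R by auto
  then have "card (Sigma A f) \<le> (\<Sum>e\<in>?R. card {p \<in> Sigma A f. {fst p, snd p} = e})"
    using card_UN_le[of ?R "\<lambda>e. {p \<in> Sigma A f. {fst p, snd p} = e}"] fin R by simp
  also have "\<dots> \<le> (\<Sum>e\<in>?R. 2)"
  proof (rule sum_mono)
    fix e assume "e \<in> ?R"
    then obtain a b where e: "e = {a, b}" by blast
    have "{p \<in> Sigma A f. {fst p, snd p} = e} \<subseteq> {(a, b), (b, a)}"
      unfolding e by (auto simp: doubleton_eq_iff)
    from card_mono[OF _ this] show "card {p \<in> Sigma A f. {fst p, snd p} = e} \<le> 2"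
      by (auto simp: card_insert_if split: if_splits)
  qed
  finally show ?thesis by simp
qed

text \<open>\<open>C\<close> is the edge set of the current container. Pairs read off from tuples of
  positive weight lie in \<open>C\<close>, so removing them shrinks the container.\<close>

locale clique_weight = spread_weight +
  fixes C :: "'a set set"
  assumes wt_pos_adj: "\<lbrakk>0 < wt (v # y); v \<in> V; y \<in> tuples V k; x \<in> set y\<rbrakk> \<Longrightarrow> {v, x} \<in> C"
begin

text \<open>
  One vertex of the tuple is eliminated in each step. A short list \<open>D\<close> of vertices, recorded together
  with their whole neighbourhoods, turns \<open>F\<close> into a family \<open>sel D\<close> of shorter tuples none of which
  is a clique. If no further vertex enlarges \<open>sel D\<close> noticeably and \<open>sel D\<close> has still lost too much
  weight, then every neighbourhood is light for the missing tuples, and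
  \<open>light_sets_avoidable\<close> applies at each vertex separately.
\<close>

lemma clique_free_sets_avoidable:
  fixes \<alpha> \<sigma> \<theta> \<eta> :: real and L m T :: nat
  defines "X \<equiv> (card V * 2 ^ card V + 1) ^ m"
    and "Y \<equiv> (card V + 1) ^ (L * T * card V)"
  assumes \<alpha>: "0 < \<alpha>" "\<alpha> \<le> 1" and \<theta>: "0 < \<theta>" and \<sigma>: "0 < \<sigma>" and \<eta>: "0 < \<eta>"
    and L: "2 * \<alpha> * \<kappa> * card V / \<theta> \<le> L"
    and m: "1 / \<eta> \<le> m"
    and large: "\<kappa> ^ T \<le> \<alpha> * card V"
    and loss: "T * (2 * \<theta> + \<alpha> * \<kappa>) \<le> \<sigma> / 4"
    and \<eta>_small: "\<eta> * \<kappa> ^ (T + 1) \<le> \<alpha> ^ T * (\<sigma> / 4)"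
    and "j \<le> T" "F \<subseteq> tuples V j" "(real j + 1) * \<sigma> \<le> (\<Sum>y\<in>F. wt y)"
  shows "avoidable (\<lambda>R. R \<subseteq> C \<and> \<sigma> * \<theta> * (card V)\<^sup>2 / (4 * \<kappa> ^ 3) \<le> card R)
    (\<lambda>H. \<forall>y\<in>F. \<not> list_clique H y) (X ^ j * Y)"
  using assms(13-)
proof (induction j arbitrary: F)
  case 0
  have "\<not> (\<forall>y\<in>F. \<not> list_clique H y)" for H
  proof -
    \<comment> \<open>Positive weight forces \<open>[] \<in> F\<close>, and the empty list is a
      clique in every \<open>H\<close>.\<close>
    have "F \<noteq> {}" using 0 \<sigma> by auto
    then have "[] \<in> F" using 0 by (auto simp: tuples_0)
    then show ?thesis by force
  qed
  then show ?case by (rule avoidable_empty)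
next
  case (Suc j)
  let ?n = "real (card V)" and ?T = "tuples V j"
  let ?Good = "\<lambda>R. R \<subseteq> C \<and> \<sigma> * \<theta> * (card V)\<^sup>2 / (4 * \<kappa> ^ 3) \<le> card R"
  let ?Q = "\<lambda>H. \<forall>y\<in>F. \<not> list_clique H y"
  note finT = finite_tuples[OF fin, of j]
  note n0 = card_V_pos
  define nb where "nb H v = {x \<in> V. {v, x} \<in> H}" for H v
  define sel where "sel D = {y \<in> ?T. \<exists>(v, N)\<in>D. v # y \<in> F \<and> set y \<subseteq> N}" for D
  define new where "new D H v = {y \<in> ?T. v # y \<in> F \<and> y \<notin> sel D \<and> set y \<subseteq> nb H v}" for D H v
  let ?Q' = "\<lambda>D H. ?Q H \<and> (\<forall>y\<in>sel D. \<not> list_clique H y) \<and> (\<forall>v\<in>V. card (new D H v) < \<eta> * ?n ^ j)"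
  let ?I = "{D. D \<subseteq> V \<times> Pow V \<and> card D \<le> m}"
  have finsel: "finite (sel D)" for D using finT by (simp add: sel_def)
  have X1: "1 \<le> X" by (simp add: X_def)
  have "avoidable ?Good ?Q (X * (X ^ j * Y))"
  proof (rule avoidable_UN[where I = ?I and Q' = ?Q'])
    have finU: "finite (V \<times> Pow V)" using fin by simp
    then show "finite ?I" by simp
    show "card ?I \<le> X"
      using card_subsets_card_le[OF finU, of m] fin
      by (simp add: X_def card_cartesian_product card_Pow)
  next
    fix H assume H: "?Q H"
    define D where "D S = (\<lambda>v. (v, nb H v)) ` S" for S
    have "card {} * (\<eta> * ?n ^ j) \<le> card (sel (D {}))" by simp
    from ex_maximal_subset[of V "\<lambda>S. card S * (\<eta> * ?n ^ j) \<le> card (sel (D S))", OF fin this]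
    obtain S where S: "S \<subseteq> V" "card S * (\<eta> * ?n ^ j) \<le> card (sel (D S))"
      and max: "\<forall>v\<in>V - S. \<not> card (insert v S) * (\<eta> * ?n ^ j) \<le> card (sel (D (insert v S)))"
      by auto
    have fS: "finite S" using S fin finite_subset by auto
    \<comment> \<open>Each vertex of \<open>S\<close> accounts for \<open>\<eta> * ?n ^ j\<close> of
      at most \<open>?n ^ j\<close> tuples, so \<open>S\<close> has at most
      \<open>1 / \<eta>\<close> elements.\<close>
    have "card (sel (D S)) \<le> card ?T"
      by (rule card_mono) (auto simp: finT sel_def)
    then have "card (sel (D S)) \<le> ?n ^ j"
      using fin by (simp add: card_tuples flip: of_nat_power)
    then have "(card S * \<eta>) * ?n ^ j \<le> 1 * ?n ^ j" using S(2) unfolding mult.assoc mult_1 by linarith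
    then have "card S * \<eta> \<le> 1" using n0 by (simp add: mult_le_cancel_right_pos)
    then have "card S \<le> 1 / \<eta>" using \<eta> by (simp add: field_simps)
    then have "card S \<le> m" using m by linarith
    then have "card (D S) \<le> m" unfolding D_def using card_image_le[OF fS] le_trans by blast
    moreover have "D S \<subseteq> V \<times> Pow V" using S(1) by (auto simp: D_def nb_def)
    \<comment> \<open>\<open>v # y\<close> is not a clique although \<open>v\<close> is joined to
      all of \<open>y\<close>, so the missing edge lies within \<open>y\<close>.\<close>
    moreover have "\<not> list_clique H y" if "y \<in> sel (D S)" for y
    proof -
      obtain v where "v # y \<in> F" "set y \<subseteq> nb H v"
        using \<open>y \<in> sel (D S)\<close> by (auto simp: sel_def D_def)
      then have "\<not> list_clique H (v # y)" "\<forall>u\<in>set y. {v, u} \<in> H"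
        using H by (auto simp: nb_def)
      then show ?thesis by simp
    qed
    moreover have "card (new (D S) H v) < \<eta> * ?n ^ j" if v: "v \<in> V" for v
    proof (cases "v \<in> S")
      case True
      then have "new (D S) H v = {}" by (auto simp: new_def sel_def D_def)
      then show ?thesis using \<eta> n0 by simp
    next
      case False
      have "sel (D (insert v S)) = sel (D S) \<union> new (D S) H v"
        by (auto simp: new_def sel_def D_def)
      moreover have "sel (D S) \<inter> new (D S) H v = {}" by (auto simp: new_def)
      moreover have "finite (new (D S) H v)" using finT by (simp add: new_def)
      ultimately have "card (sel (D (insert v S))) = card (sel (D S)) + card (new (D S) H v)"
        using finsel by (simp add: card_Un_disjoint)
      moreover have "\<not> card (insert v S) * (\<eta> * ?n ^ j) \<le> card (sel (D (insert v S)))"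
        using max v False by blast
      moreover have "card (insert v S) * (\<eta> * ?n ^ j) = card S * (\<eta> * ?n ^ j) + \<eta> * ?n ^ j"
        using False fS by (simp add: algebra_simps)
      ultimately show ?thesis using S(2) by simp
    qed
    ultimately show "\<exists>D\<in>?I. ?Q' D H"
      using H by (intro bexI[of _ "D S"]) auto
  next
    fix D assume "D \<in> ?I"
    have selT: "sel D \<subseteq> ?T" by (auto simp: sel_def)
    show "avoidable ?Good (?Q' D) (X ^ j * Y)"
    proof (cases "(real j + 1) * \<sigma> \<le> (\<Sum>y\<in>sel D. wt y)")
      case True
      have "j \<le> T" using Suc.prems by simp
      from Suc.IH[OF this selT True] show ?thesis
        by (rule avoidable_mono) auto
    next
      case False
      \<comment> \<open>The factor \<open>?n\<close> makes the weight of the tuples that start with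
        \<open>v\<close> comparable to \<open>wt\<close> on their tails, as
        \<open>light_sets_avoidable\<close> requires.\<close>
      define w where "w v y = (if v # y \<in> F \<and> y \<notin> sel D then ?n * wt (v # y) else 0)" for v y
      define mass where "mass v = (\<Sum>y\<in>?T. w v y)" for v
      define rich where "rich = {v \<in> V. \<sigma> / 2 \<le> mass v}"
      have richV: "rich \<subseteq> V" by (auto simp: rich_def)
      have finrich: "finite rich" using richV fin finite_subset by auto
      have w: "0 \<le> w v y \<and> w v y \<le> \<kappa> * wt y" if "v \<in> V" "y \<in> ?T" for v y
      proof -
        have "?n * wt (v # y) \<le> ?n * (\<kappa> / ?n * wt y)"
          using wt_Cons_le[OF that] by (intro mult_left_mono) auto
        also have "\<dots> = \<kappa> * wt y" using n0 by simp
        finally show ?thesis using wt_nonneg \<kappa> by (simp add: w_def)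
      qed
      have mass_le: "mass v \<le> \<kappa>" if "v \<in> V" for v
      proof -
        have "mass v \<le> (\<Sum>y\<in>?T. \<kappa> * wt y)"
          unfolding mass_def using w that by (intro sum_mono) auto
        also have "\<dots> \<le> \<kappa> * 1"
          unfolding sum_distrib_left[symmetric] using \<kappa> sum_wt_le_1 by (intro mult_left_mono) auto
        finally show ?thesis by simp
      qed
      have "(\<Sum>z\<in>F. wt z) = (\<Sum>z\<in>tuples V (Suc j). if z \<in> F then wt z else 0)"
        using Suc.prems(2) finite_tuples[OF fin, of "Suc j"]
        by (subst sum.If_cases) (auto intro!: sum.cong)
      also have "\<dots> = (\<Sum>y\<in>?T. \<Sum>v\<in>V. if v # y \<in> F then wt (v # y) else 0)"
        by (rule sum_tuples_Suc)
      also have "\<dots> \<le> (\<Sum>y\<in>?T. (if y \<in> sel D then wt y else 0) + (\<Sum>v\<in>V. w v y) / ?n)"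
      proof (rule sum_mono)
        fix y assume y: "y \<in> ?T"
        show "(\<Sum>v\<in>V. if v # y \<in> F then wt (v # y) else 0)
          \<le> (if y \<in> sel D then wt y else 0) + (\<Sum>v\<in>V. w v y) / ?n"
        proof (cases "y \<in> sel D")
          case True
          have "(\<Sum>v\<in>V. if v # y \<in> F then wt (v # y) else 0) \<le> (\<Sum>v\<in>V. wt (v # y))"
            using wt_nonneg by (intro sum_mono) auto
          also have "\<dots> \<le> wt y" using y by (rule sum_wt_Cons_le)
          finally show ?thesis using True by (simp add: w_def)
        next
          case False
          have "(\<Sum>v\<in>V. w v y) / ?n = (\<Sum>v\<in>V. if v # y \<in> F then wt (v # y) else 0)"
            unfolding sum_divide_distrib using False n0 by (intro sum.cong) (auto simp: w_def)
          then show ?thesis using False by simp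
        qed
      qed
      also have "\<dots> = (\<Sum>y\<in>sel D. wt y) + (\<Sum>y\<in>?T. (\<Sum>v\<in>V. w v y) / ?n)"
        unfolding sum.distrib using finT selT
        by (subst sum.If_cases) (auto simp: sel_def intro!: sum.cong)
      also have "(\<Sum>y\<in>?T. (\<Sum>v\<in>V. w v y) / ?n) = (\<Sum>v\<in>V. mass v) / ?n"
        unfolding mass_def sum_divide_distrib[symmetric] by (subst sum.swap) simp
      \<comment> \<open>\<open>F\<close> weighs at least \<open>(j + 2) * \<sigma>\<close> and
        \<open>sel D\<close> less than \<open>(j + 1) * \<sigma>\<close>, so the average mass is at
        least \<sigma>. As no mass exceeds \<kappa>, many vertices are then rich.\<close>
      finally have "\<sigma> \<le> (\<Sum>v\<in>V. mass v) / ?n"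
        using False Suc.prems(3) by (simp add: algebra_simps)
      then have "\<sigma> * ?n \<le> (\<Sum>v\<in>V. mass v)"
        using n0 by (simp add: field_simps)
      also have "\<dots> = (\<Sum>v\<in>rich \<union> (V - rich). mass v)"
        using richV by (intro sum.cong) auto
      also have "\<dots> = (\<Sum>v\<in>rich. mass v) + (\<Sum>v\<in>V - rich. mass v)"
        using fin finrich by (intro sum.union_disjoint) auto
      also have "(\<Sum>v\<in>rich. mass v) \<le> (\<Sum>v\<in>rich. \<kappa>)"
        using mass_le richV by (intro sum_mono) auto
      also have "(\<Sum>v\<in>V - rich. mass v) \<le> (\<Sum>v\<in>V - rich. \<sigma> / 2)"
        by (intro sum_mono) (auto simp: rich_def)
      also have "\<dots> \<le> (\<Sum>v\<in>V. \<sigma> / 2)"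
        using fin \<sigma> by (intro sum_mono2) auto
      finally have card_rich: "\<sigma> * ?n / (2 * \<kappa>) \<le> card rich"
        using \<kappa> by (simp add: field_simps)

      let ?Good1 = "\<lambda>v R. R \<subseteq> V \<and> \<theta> * card V / \<kappa>\<^sup>2 \<le> card R \<and>
        (\<forall>x\<in>R. \<exists>y\<in>?T. x \<in> set y \<and> 0 < w v y)"
      let ?Q1 = "\<lambda>v N. N \<subseteq> V \<and> (\<Sum>y\<in>tuples N j. w v y) < \<alpha> ^ j * (\<sigma> / 4)"
      have "avoidable (?Good1 v) (?Q1 v) ((card V + 1) ^ (L * j))" if v: "v \<in> rich" for v
      proof (rule light_sets_avoidable[OF \<alpha>(1) \<theta> L])
        have "\<kappa> ^ j \<le> \<kappa> ^ T"
          using \<kappa> Suc.prems(1) by (intro power_increasing) auto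
        then show "\<kappa> ^ j \<le> \<alpha> * ?n" using large by linarith
        show "0 \<le> w v y \<and> w v y \<le> \<kappa> * wt y" if "y \<in> ?T" for y
          using w v richV that by blast
        have "j * (2 * \<theta> + \<alpha> * \<kappa>) \<le> T * (2 * \<theta> + \<alpha> * \<kappa>)"
          using Suc.prems(1) \<theta> \<alpha> \<kappa> by (intro mult_right_mono) auto
        then show "\<sigma> / 4 + j * (2 * \<theta> + \<alpha> * \<kappa>) \<le> (\<Sum>y\<in>?T. w v y)"
          using loss v by (simp add: rich_def mass_def)
      qed
      then have "\<forall>v\<in>rich. \<exists>\<S>. finite \<S> \<and> card \<S> \<le> (card V + 1) ^ (L * j) \<and>
          (\<forall>R\<in>\<S>. ?Good1 v R) \<and> (\<forall>N. ?Q1 v N \<longrightarrow> (\<exists>R\<in>\<S>. R \<inter> N = {}))"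
        unfolding avoidable_def by (intro ballI)
      from bchoice[OF this] obtain \<R> where fam:
        "\<forall>v\<in>rich. finite (\<R> v) \<and> card (\<R> v) \<le> (card V + 1) ^ (L * j) \<and>
          (\<forall>R\<in>\<R> v. ?Good1 v R) \<and> (\<forall>N. ?Q1 v N \<longrightarrow> (\<exists>R\<in>\<R> v. R \<inter> N = {}))"
        by (elim exE)
      have \<R>: "finite (\<R> v)" "card (\<R> v) \<le> (card V + 1) ^ (L * j)"
        "\<And>R. R \<in> \<R> v \<Longrightarrow> ?Good1 v R" "\<And>N. ?Q1 v N \<Longrightarrow> \<exists>R\<in>\<R> v. R \<inter> N = {}"
        if "v \<in> rich" for v
        using bspec[OF fam that] by simp_all
      \<comment> \<open>\<open>f\<close> chooses for each rich \<open>v\<close> a set of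
        non-neighbours; the number of these choices is the factor \<open>Y\<close>.\<close>
      define pairs where "pairs f = {{v, x} | v x. v \<in> rich \<and> x \<in> f v}" for f :: "'a \<Rightarrow> 'a set"
      let ?P = "PiE rich \<R>"
      have finP: "finite ?P" using finrich \<R>(1) by (intro finite_PiE) auto
      have "card ?P = (\<Prod>v\<in>rich. card (\<R> v))" using finrich by (rule card_PiE)
      also have "\<dots> \<le> (\<Prod>v\<in>rich. (card V + 1) ^ (L * j))"
        using \<R>(2) by (intro prod_mono) auto
      also have "\<dots> = (card V + 1) ^ (L * j * card rich)" by (simp add: power_mult)
      also have "\<dots> \<le> Y"
        unfolding Y_def using Suc.prems(1) card_mono[OF fin richV]
        by (intro power_increasing mult_le_mono) auto
      finally have cardP: "card (pairs ` ?P) \<le> Y"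
        using card_image_le[OF finP] le_trans by blast
      have good: "?Good (pairs f)" if f: "f \<in> ?P" for f
      proof -
        have f1: "?Good1 v (f v)" if "v \<in> rich" for v
          using \<R>(3) f that by (meson PiE_mem)
        have "pairs f \<subseteq> C"
        proof
          fix e assume "e \<in> pairs f"
          then obtain v x where e: "e = {v, x}" "v \<in> rich" "x \<in> f v" by (auto simp: pairs_def)
          then obtain y where "y \<in> ?T" "x \<in> set y" "0 < w v y" using f1 by blast
          then show "e \<in> C"
            using wt_pos_adj[of v y j x] e richV n0
            by (auto simp: w_def zero_less_mult_iff split: if_splits)
        qed
        moreover have "\<sigma> * \<theta> * (card V)\<^sup>2 / (4 * \<kappa> ^ 3) \<le> card (pairs f)"
        proof -
          have finf: "finite (f v)" if "v \<in> rich" for v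
            using f1[OF that] fin finite_subset by blast
          have "(\<sigma> * ?n / (2 * \<kappa>)) * (\<theta> * ?n / \<kappa>\<^sup>2) \<le> card rich * (\<theta> * ?n / \<kappa>\<^sup>2)"
            using card_rich \<theta> n0 by (intro mult_right_mono) auto
          also have "\<dots> = (\<Sum>v\<in>rich. \<theta> * ?n / \<kappa>\<^sup>2)" by simp
          also have "\<dots> \<le> (\<Sum>v\<in>rich. real (card (f v)))"
            using f1 by (intro sum_mono) auto
          also have "\<dots> = real (card (Sigma rich f))"
            using finrich finf by (subst card_SigmaI) auto
          also have "\<dots> \<le> real (2 * card (pairs f))"
            unfolding pairs_def using card_Sigma_le_twice_pairs[OF finrich finf]
            by (subst of_nat_le_iff) auto
          finally show ?thesis
            using \<kappa> by (simp add: field_simps power2_eq_square power3_eq_cube)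
        qed
        ultimately show ?thesis by blast
      qed
      have "\<exists>R\<in>pairs ` ?P. R \<inter> H = {}" if H: "?Q' D H" for H
      proof -
        have "\<exists>R\<in>\<R> v. R \<inter> nb H v = {}" if v: "v \<in> rich" for v
        proof (rule \<R>(4)[OF v], intro conjI)
          show nbV: "nb H v \<subseteq> V" by (auto simp: nb_def)
          have vV: "v \<in> V" using v richV by blast
          let ?c = "?n * (\<kappa> / ?n) ^ Suc j"
          have c: "0 < ?c" using n0 \<kappa> by (intro mult_pos_pos zero_less_power divide_pos_pos) auto
          \<comment> \<open>Inside the neighbourhood only tails in \<open>new D H v\<close> count:
            fewer than \<open>\<eta> * ?n ^ j\<close>, of weight at most \<open>?c\<close> each. In
            the product the powers of \<open>?n\<close> cancel.\<close>
          have "(\<Sum>y\<in>tuples (nb H v) j. w v y) \<le> (\<Sum>y\<in>tuples (nb H v) j. if y \<in> new D H v then ?c else 0)"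
          proof (rule sum_mono)
            fix y assume y: "y \<in> tuples (nb H v) j"
            then have yT: "y \<in> ?T" and sy: "set y \<subseteq> nb H v"
              using nbV tuples_mono by (auto simp: tuples_def)
            have "wt (v # y) \<le> (\<kappa> / ?n) ^ Suc j"
              using wt_le_power[of "v # y" "Suc j"] vV yT by (simp add: Cons_in_tuples)
            then have "?n * wt (v # y) \<le> ?c" by (intro mult_left_mono) auto
            then show "w v y \<le> (if y \<in> new D H v then ?c else 0)"
              using yT sy by (auto simp: w_def new_def)
          qed
          also have "\<dots> = card (tuples (nb H v) j \<inter> new D H v) * ?c"
            using finite_tuples[OF finite_subset[OF nbV fin]]
            by (subst sum.If_cases) auto
          also have "\<dots> \<le> card (new D H v) * ?c"
            using c finT by (intro mult_right_mono) (auto intro!: card_mono simp: new_def)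
          also have "\<dots> < \<eta> * ?n ^ j * ?c"
            using H vV c by (intro mult_strict_right_mono) auto
          also have "\<dots> = \<eta> * \<kappa> ^ Suc j"
            using n0 by (simp add: field_simps)
          also have "\<dots> \<le> \<eta> * \<kappa> ^ (T + 1)"
            using \<eta> \<kappa> Suc.prems(1) by (intro mult_left_mono power_increasing) auto
          also have "\<dots> \<le> \<alpha> ^ T * (\<sigma> / 4)" by fact
          also have "\<dots> \<le> \<alpha> ^ j * (\<sigma> / 4)"
            using \<alpha> \<sigma> Suc.prems(1) by (intro mult_right_mono power_decreasing) auto
          finally show "(\<Sum>y\<in>tuples (nb H v) j. w v y) < \<alpha> ^ j * (\<sigma> / 4)" .
        qed
        then obtain f where f: "\<And>v. v \<in> rich \<Longrightarrow> f v \<in> \<R> v \<and> f v \<inter> nb H v = {}" by metis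
        have "pairs (restrict f rich) \<inter> H = {}"
          using f \<R>(3) by (fastforce simp: pairs_def nb_def)
        moreover have "restrict f rich \<in> ?P" using f by auto
        ultimately show ?thesis by blast
      qed
      moreover have "card (pairs ` ?P) \<le> X ^ j * Y"
        using cardP X1 by (metis le_trans mult_le_mono1 nat_mult_1 one_le_power)
      ultimately show ?thesis
        unfolding avoidable_def using finP good by (intro exI[of _ "pairs ` ?P"]) auto
    qed
  qed
  then show ?case by (simp add: mult.assoc)
qed

end

section \<open>Containers that are almost complete graphs\<close>

text \<open>A round only lists the newly lost pairs; the pairs \<open>M\<close> lost before are
  added back here.\<close>

lemma avoidable_Un:
  assumes "avoidable Good Q m" "\<And>R. Good R \<Longrightarrow> Good' (M \<union> R)"
  shows "avoidable Good' (\<lambda>X. Q X \<and> M \<inter> X = {}) m"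
proof -
  obtain \<R> where \<R>: "finite \<R>" "card \<R> \<le> m" "\<forall>R\<in>\<R>. Good R"
    "\<forall>X. Q X \<longrightarrow> (\<exists>R\<in>\<R>. R \<inter> X = {})"
    using assms(1) unfolding avoidable_def by metis
  have "card ((\<union>) M ` \<R>) \<le> m"
    using card_image_le[OF \<R>(1)] \<R>(2) le_trans by blast
  moreover have "\<exists>R\<in>(\<union>) M ` \<R>. R \<inter> X = {}" if X: "Q X \<and> M \<inter> X = {}" for X
  proof -
    obtain R where "R \<in> \<R>" "R \<inter> X = {}" using \<R>(4) X by blast
    then show ?thesis using X by (intro bexI[of _ "M \<union> R"]) auto
  qed
  ultimately show ?thesis
    unfolding avoidable_def using \<R>(1,3) assms(2)
    by (intro exI[of _ "(\<union>) M ` \<R>"]) auto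
qed

text \<open>
  The graph \<open>[V]\<^bsup>2\<^esup> - M\<close> is the current container. At least half of its vertices miss at most
  \<open>17 n / (36 t)\<close> others, so inside this core fewer than \<open>t\<close> vertices have at least
  \<open>n / 2 - 17 n / 36 = n / 36\<close> common neighbours. Choosing the vertices of a clique one after the
  other uniformly at random in the core is therefore a spread distribution.
\<close>

locale almost_complete_graph =
  fixes V :: "'a set" and M :: "'a set set" and t :: nat
  assumes fin: "finite V" and M: "M \<subseteq> [V]\<^bsup>2\<^esup>" and t: "1 \<le> t"
    and large: "72 * t \<le> card V" and few: "card M < (card V)\<^sup>2 / (9 * t)"
begin

text \<open>For \<open>v \<in> V\<close> this contains \<open>v\<close> itself, as
  \<open>{v, v}\<close> has one element. Bounding a union of these sets thus also covers the
  vertices already chosen.\<close>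

definition nonadj :: "'a \<Rightarrow> 'a set"
  where "nonadj v = {x \<in> V. {v, x} \<notin> [V]\<^bsup>2\<^esup> - M}"

definition core :: "'a set"
  where "core = {v \<in> V. card (nonadj v) \<le> 17 * card V / (36 * t)}"

definition common :: "'a list \<Rightarrow> 'a set"
  where "common y = {x \<in> core. \<forall>u\<in>set y. {x, u} \<in> [V]\<^bsup>2\<^esup> - M}"

text \<open>The guard sets the weight to 0 where the common neighbourhood is small, so the spread
  bound with constant 36 holds for every tuple.\<close>

fun wt :: "'a list \<Rightarrow> real"
  where
    "wt [] = 1"
  | "wt (x # y) = (if x \<in> common y \<and> card V \<le> 36 * card (common y) then wt y / card (common y) else 0)"

lemma card_V_pos: "0 < card V"
  using large t by simp

lemma finite_nonadj: "finite (nonadj v)"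
  using fin by (simp add: nonadj_def)

lemma core_subset: "core \<subseteq> V"
  by (auto simp: core_def)

lemma finite_core: "finite core"
  using core_subset fin finite_subset by auto

lemma finite_common: "finite (common y)"
  using finite_core by (simp add: common_def)

lemma common_subset: "common y \<subseteq> V"
  using core_subset by (auto simp: common_def)

text \<open>Ordered non-adjacent pairs are the diagonal and the two orders of each pair in
  \<open>M\<close>.\<close>

lemma sum_card_nonadj_le: "(\<Sum>v\<in>V. card (nonadj v)) \<le> card V + 2 * card M"
proof -
  have finM: "finite M"
    using M fin finite_imp_finite_nsets finite_subset by blast
  have "(\<Sum>v\<in>V. card (nonadj v)) = card (Sigma V nonadj)"
    using fin finite_nonadj by simp
  also have "\<dots> \<le> card ((\<lambda>v. (v, v)) ` V \<union> (\<Union>e\<in>M. {p. {fst p, snd p} = e \<and> p \<in> V \<times> V}))"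
    using fin finM
    by (intro card_mono) (auto simp: nonadj_def finite_subset[of _ "V \<times> V"])
  also have "\<dots> \<le> card ((\<lambda>v. (v, v)) ` V) + card (\<Union>e\<in>M. {p. {fst p, snd p} = e \<and> p \<in> V \<times> V})"
    by (rule card_Un_le)
  also have "\<dots> \<le> card V + (\<Sum>e\<in>M. card {p. {fst p, snd p} = e \<and> p \<in> V \<times> V})"
    using card_image_le[OF fin, of "\<lambda>v. (v, v)"] card_UN_le[OF finM] by (rule add_mono)
  also have "(\<Sum>e\<in>M. card {p. {fst p, snd p} = e \<and> p \<in> V \<times> V}) \<le> (\<Sum>e\<in>M. 2)"
  proof (rule sum_mono)
    fix e assume "e \<in> M"
    then obtain a b where e: "e = {a, b}" using M by (auto elim!: nsets2_E)
    have "{p. {fst p, snd p} = e \<and> p \<in> V \<times> V} \<subseteq> {(a, b), (b, a)}"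
      unfolding e by (auto simp: doubleton_eq_iff)
    from card_mono[OF _ this] show "card {p. {fst p, snd p} = e \<and> p \<in> V \<times> V} \<le> 2"
      by (auto simp: card_insert_if split: if_splits)
  qed
  finally show ?thesis by simp
qed

text \<open>With \<open>n = card V\<close>: otherwise the vertices outside the core would account
  for at least \<open>17 * n ^ 2 / (72 * t)\<close> ordered non-adjacent pairs, while there are
  fewer than \<open>n + 16 * n ^ 2 / (72 * t)\<close>. This contradicts
  \<open>large\<close>.\<close>

lemma card_core_ge: "card V / 2 \<le> card core"
proof (rule ccontr)
  let ?n = "real (card V)"
  let ?b = "17 * ?n / (36 * t)"
  assume "\<not> ?n / 2 \<le> card core"
  moreover have "card (V - core) = card V - card core" "card core \<le> card V"
    using core_subset finite_core fin by (auto simp: card_Diff_subset card_mono)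
  ultimately have "?n / 2 \<le> card (V - core)" by (simp add: of_nat_diff)
  then have "?n / 2 * ?b \<le> card (V - core) * ?b"
    by (rule mult_right_mono) simp
  also have "\<dots> = (\<Sum>v\<in>V - core. ?b)" by simp
  also have "\<dots> \<le> (\<Sum>v\<in>V - core. real (card (nonadj v)))"
    by (intro sum_mono) (auto simp: core_def)
  also have "\<dots> \<le> (\<Sum>v\<in>V. real (card (nonadj v)))"
    using fin by (intro sum_mono2) auto
  also have "\<dots> \<le> ?n + 2 * card M"
    using sum_card_nonadj_le by (simp flip: of_nat_sum)
  also have "\<dots> < ?n + 2 * (?n\<^sup>2 / (9 * t))"
    using few by simp
  finally have "17 * ?n\<^sup>2 / (72 * t) < ?n + 16 * ?n\<^sup>2 / (72 * t)"
    by (simp add: power2_eq_square)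
  then have "?n\<^sup>2 / (72 * t) < ?n"
    by (simp add: field_simps)
  then have "?n < 72 * t"
    using card_V_pos t by (simp add: field_simps power2_eq_square)
  then show False
    using large by linarith
qed

lemma card_common_ge:
  assumes "set y \<subseteq> core" "length y < t"
  shows "card V \<le> 36 * card (common y)"
proof -
  let ?n = "real (card V)"
  let ?b = "17 * ?n / (36 * t)"
  have "core \<subseteq> common y \<union> (\<Union>u\<in>set y. nonadj u)"
    using core_subset by (auto simp: common_def nonadj_def insert_commute)
  then have "card core \<le> card (common y \<union> (\<Union>u\<in>set y. nonadj u))"
    using finite_common finite_nonadj by (intro card_mono) auto
  also have "\<dots> \<le> card (common y) + card (\<Union>u\<in>set y. nonadj u)"
    by (rule card_Un_le)
  also have "card (\<Union>u\<in>set y. nonadj u) \<le> (\<Sum>u\<in>set y. card (nonadj u))"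
    by (rule card_UN_le) simp
  finally have "real (card core) \<le> card (common y) + (\<Sum>u\<in>set y. real (card (nonadj u)))"
    by (simp flip: of_nat_sum of_nat_add)
  also have "(\<Sum>u\<in>set y. real (card (nonadj u))) \<le> (\<Sum>u\<in>set y. ?b)"
    using assms(1) by (intro sum_mono) (auto simp: core_def)
  also have "\<dots> = card (set y) * ?b" by simp
  also have "\<dots> \<le> t * ?b"
    using assms(2) card_length[of y] by (intro mult_right_mono) auto
  also have "\<dots> = 17 * ?n / 36" using t by simp
  finally show ?thesis using card_core_ge by simp
qed

lemma wt_nonneg: "0 \<le> wt y"
  by (induction y) auto

lemma wt_pos_imp:
  assumes "0 < wt y"
  shows "set y \<subseteq> core \<and> distinct y"
  using assms
proof (induction y)
  case (Cons x y)
  then have x: "x \<in> common y" and "0 < wt y"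
    using wt_nonneg[of y] by (auto simp: zero_less_divide_iff split: if_splits)
  moreover have "x \<notin> set y"
    using x by (auto simp: common_def)
  ultimately show ?case
    using Cons.IH by (auto simp: common_def)
qed simp

lemma sum_wt_Cons:
  "(\<Sum>x\<in>V. wt (x # y)) = (if card V \<le> 36 * card (common y) then wt y else 0)"
proof (cases "card V \<le> 36 * card (common y)")
  case True
  then have "(\<Sum>x\<in>V. wt (x # y)) = (\<Sum>x\<in>common y. wt y / card (common y))"
    using fin common_subset by (simp add: sum.If_cases Int_absorb1 cong: if_cong flip: Collect_mem_eq)
  then show ?thesis using True card_V_pos by auto
qed simp

text \<open>No weight is lost up to length \<open>t\<close>: tuples of positive weight lie in the
  core, where \<open>card_common_ge\<close> keeps the guard of \<open>wt\<close> true.\<close>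

lemma sum_wt_eq_1: "k \<le> t \<Longrightarrow> (\<Sum>y\<in>tuples V k. wt y) = 1"
proof (induction k)
  case 0
  then show ?case by (simp add: tuples_0)
next
  case (Suc k)
  have "(\<Sum>x\<in>V. wt (x # y)) = wt y" if "y \<in> tuples V k" for y
  proof (cases "0 < wt y")
    case True
    then have "card V \<le> 36 * card (common y)"
      using wt_pos_imp[OF True] Suc.prems that by (intro card_common_ge) (auto simp: tuples_def)
    then show ?thesis by (simp only: sum_wt_Cons if_True)
  next
    case False
    then have "wt y = 0" using wt_nonneg[of y] by linarith
    then show ?thesis by (simp add: sum_wt_Cons del: wt.simps)
  qed
  then show ?case
    using Suc by (simp add: sum_tuples_Suc del: wt.simps)
qed

sublocale clique_weight V 36 wt "[V]\<^bsup>2\<^esup> - M"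
proof
  show "finite V" by (rule fin)
  show "V \<noteq> {}" using card_V_pos by auto
  show "wt (x # y) \<le> 36 / card V * wt y" for x y
  proof (cases "x \<in> common y \<and> card V \<le> 36 * card (common y)")
    case True
    then have "0 < card (common y)" using card_V_pos by auto
    then have "1 / real (card (common y)) \<le> 36 / real (card V)"
      using True card_V_pos by (simp add: field_simps)
    then show ?thesis
      using True wt_nonneg[of y] mult_right_mono by fastforce
  qed (use wt_nonneg[of y] in auto)
  show "(\<Sum>x\<in>V. wt (x # y)) \<le> wt y" for y
    unfolding sum_wt_Cons using wt_nonneg by simp
  show "{v, x} \<in> [V]\<^bsup>2\<^esup> - M" if "0 < wt (v # y)" "x \<in> set y" for v y x
    using that by (auto simp: common_def split: if_splits)
qed (auto intro: wt_nonneg)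

text \<open>Positive weight makes the entries distinct, which gives the clique its size
  \<open>k\<close>.\<close>

lemma list_clique_imp_has_clique:
  assumes "y \<in> tuples V k" "0 < wt y" "list_clique H y"
  shows "has_clique V H k"
proof -
  have "clique (set z) H" if "list_clique H z" for z
    using that by (induction z) (auto simp: clique_def insert_commute)
  then show ?thesis
    unfolding has_clique_def using assms wt_pos_imp[OF assms(2)]
    by (intro bexI[of _ "set y"]) (auto simp: nsets_def tuples_def distinct_card)
qed

text \<open>\<sigma> is chosen so that the total weight 1 is exactly the
  \<open>(t + 1) * \<sigma>\<close> required for eliminating \<open>t\<close> vertices.\<close>

lemma clique_free_graphs_avoidable:
  fixes \<alpha> \<theta> \<eta> :: real and L m :: nat
  defines "\<sigma> \<equiv> 1 / (real t + 1)"
  assumes \<alpha>: "0 < \<alpha>" "\<alpha> \<le> 1" and \<theta>: "0 < \<theta>" and \<eta>: "0 < \<eta>"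
    and "2 * \<alpha> * 36 * card V / \<theta> \<le> L"
    and "1 / \<eta> \<le> m"
    and "36 ^ t \<le> \<alpha> * card V"
    and "t * (2 * \<theta> + \<alpha> * 36) \<le> \<sigma> / 4"
    and "\<eta> * 36 ^ (t + 1) \<le> \<alpha> ^ t * (\<sigma> / 4)"
  shows "avoidable (\<lambda>R. R \<subseteq> [V]\<^bsup>2\<^esup> - M \<and> \<sigma> * \<theta> * (card V)\<^sup>2 / (4 * 36 ^ 3) \<le> card R)
    (\<lambda>H. \<not> has_clique V H t)
    (((card V * 2 ^ card V + 1) ^ m) ^ t * (card V + 1) ^ (L * t * card V))"
proof -
  let ?F = "{y \<in> tuples V t. 0 < wt y}"
  have "(\<Sum>y\<in>?F. wt y) = (\<Sum>y\<in>tuples V t. wt y)"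
    using finite_tuples[OF fin] wt_nonneg
    by (intro sum.mono_neutral_left) (auto simp: order_less_le)
  then have mass: "(real t + 1) * \<sigma> \<le> (\<Sum>y\<in>?F. wt y)"
    using sum_wt_eq_1[of t] by (simp add: \<sigma>_def)
  have "0 < \<sigma>" by (simp add: \<sigma>_def)
  from clique_free_sets_avoidable[OF \<alpha> \<theta> this \<eta> assms(6-10) order_refl _ mass]
  show ?thesis
    by (rule avoidable_mono) (use list_clique_imp_has_clique in auto)
qed

end

section \<open>Iteration and choice of parameters\<close>

text \<open>Each round adds a fixed number of missing pairs. Once the first term of the minimum is
  reached, the container is no longer almost complete and is kept.\<close>

lemma graph_containers_iterate:
  fixes V :: "'a set" and \<alpha> \<theta> \<eta> :: real and L m t :: nat
  defines "\<sigma> \<equiv> 1 / (real t + 1)"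
  defines "K \<equiv> ((card V * 2 ^ card V + 1) ^ m) ^ t * (card V + 1) ^ (L * t * card V)"
  assumes "finite V" "1 \<le> t" "72 * t \<le> card V"
    and "0 < \<alpha>" "\<alpha> \<le> 1" "0 < \<theta>" "0 < \<eta>"
    and "2 * \<alpha> * 36 * card V / \<theta> \<le> L"
    and "1 / \<eta> \<le> m"
    and "36 ^ t \<le> \<alpha> * card V"
    and "t * (2 * \<theta> + \<alpha> * 36) \<le> \<sigma> / 4"
    and "\<eta> * 36 ^ (t + 1) \<le> \<alpha> ^ t * (\<sigma> / 4)"
  shows "avoidable (\<lambda>R. R \<subseteq> [V]\<^bsup>2\<^esup> \<and>
      min ((card V)\<^sup>2 / (9 * t)) (i * (\<sigma> * \<theta> * (card V)\<^sup>2 / (4 * 36 ^ 3))) \<le> card R)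
    (\<lambda>H. \<not> has_clique V H t) (K ^ i)"
proof (induction i)
  case 0
  show ?case by (rule avoidable_single[of _ "{}"]) auto
next
  case (Suc i)
  let ?\<rho> = "\<sigma> * \<theta> * (card V)\<^sup>2 / (4 * 36 ^ 3)"
  let ?Good = "\<lambda>R. R \<subseteq> [V]\<^bsup>2\<^esup> \<and> min ((card V)\<^sup>2 / (9 * t)) (Suc i * ?\<rho>) \<le> card R"
  have K1: "1 \<le> K" unfolding K_def by simp
  have "avoidable ?Good (\<lambda>H. \<not> has_clique V H t) (K ^ i * K)"
    using Suc
  proof (rule avoidable_trans)
    fix M assume missing: "M \<subseteq> [V]\<^bsup>2\<^esup> \<and> min ((card V)\<^sup>2 / (9 * t)) (i * ?\<rho>) \<le> card M"
    show "avoidable ?Good (\<lambda>H. \<not> has_clique V H t \<and> M \<inter> H = {}) K"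
    proof (cases "(card V)\<^sup>2 / (9 * t) \<le> card M")
      case True
      with missing K1 show ?thesis by (intro avoidable_single[of _ M]) auto
    next
      case False
      interpret almost_complete_graph V M t
        using assms(3-5) missing False by unfold_locales auto
      have finE: "finite ([V]\<^bsup>2\<^esup>)" using assms(3) by (rule finite_imp_finite_nsets)
      note step = clique_free_graphs_avoidable[of \<alpha> \<theta> \<eta> L m, folded \<sigma>_def K_def,
          OF assms(6-14)]
      show ?thesis
      proof (rule avoidable_Un[OF step])
        fix R assume R: "R \<subseteq> [V]\<^bsup>2\<^esup> - M \<and> ?\<rho> \<le> card R"
        have "card (M \<union> R) = card M + card R"
          using R M finE by (intro card_Un_disjoint) (auto intro: finite_subset)
        moreover have "i * ?\<rho> \<le> card M" using missing False unfolding min_le_iff_disj by blast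
        moreover have "Suc i * ?\<rho> = i * ?\<rho> + ?\<rho>" by (simp only: of_nat_Suc distrib_right mult_1 add.commute)
        ultimately have "Suc i * ?\<rho> \<le> card (M \<union> R)" using R by linarith
        then show "?Good (M \<union> R)" using missing R by (auto simp: min_le_iff_disj)
      qed
    qed
  qed
  then show ?case by (simp add: mult.commute)
qed

lemma graph_containers:
  fixes V :: "'a set" and t :: nat
  defines "n \<equiv> real (card V)"
  defines "l \<equiv> log 2 n"
  assumes fin: "finite V" and t: "1 \<le> t" "t \<le> l / (120 * log 2 l)"
    and l: "36 \<le> l" and nl: "72 * l \<le> n"
    and big1: "2 * n * (145 * l * sqrt n) * l * (331777 * l\<^sup>2) \<le> n\<^sup>2 / (2 * l\<^sup>2)"
    and big2: "2 * l * (1152 * n / l ^ 8 + 1) * l * n * (331777 * l\<^sup>2) \<le> n\<^sup>2 / (2 * l\<^sup>2)"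
  shows "avoidable (\<lambda>M. M \<subseteq> [V]\<^bsup>2\<^esup> \<and> n\<^sup>2 / (9 * t) \<le> card M)
    (\<lambda>H. \<not> has_clique V H t) (nat \<lfloor>2 powr (n\<^sup>2 / l\<^sup>2)\<rfloor>)"
proof -
  have n: "1 \<le> n" using nl l by linarith
  have npow: "n = 2 powr l" using n by (simp add: l_def)
  have logl: "1 \<le> log 2 l" using l by (simp add: le_log_iff)
  have tlog: "120 * (t * log 2 l) \<le> l"
    using t(2) logl by (simp add: field_simps)
  moreover have "real t * 1 \<le> t * log 2 l" using logl by (intro mult_left_mono) auto
  ultimately have t120: "120 * real t \<le> l" by linarith
  then have t1l: "real t + 1 \<le> l" using t(1) l by linarith
  \<comment> \<open>The exponent 10 makes \<open>\<alpha> * t\<close> small against \<sigma> and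
    \<open>L\<close> at most of order \<open>n / l ^ 8\<close>, so that the containers of
    neighbourhoods add about \<open>n ^ 2 / l ^ 4\<close> to the final exponent; still
    \<open>\<alpha> ^ t\<close> is at least \<open>1 / sqrt n\<close>. Below, \<theta> uses half of
    the allowed loss and \<eta> is as large as its condition permits.\<close>
  define \<alpha> where "\<alpha> = 1 / l ^ 10"
  define \<sigma> where "\<sigma> = 1 / (real t + 1)"
  define \<theta> where "\<theta> = \<sigma> / (16 * t)"
  define \<eta> where "\<eta> = \<alpha> ^ t * (\<sigma> / 4) / 36 ^ (t + 1)"
  define m where "m = nat \<lceil>1 / \<eta>\<rceil>"
  define L where "L = nat \<lceil>2 * \<alpha> * 36 * n / \<theta>\<rceil>"
  define I where "I = nat \<lceil>331776 * l\<^sup>2\<rceil>"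
  let ?\<rho> = "\<sigma> * \<theta> * n\<^sup>2 / (4 * 36 ^ 3)"
  have l1: "1 \<le> l ^ k" for k using l by (simp add: one_le_power)
  have lpos: "0 < l ^ k" for k using l by simp
  have \<alpha>: "0 < \<alpha>" "\<alpha> \<le> 1" using l1[of 10] lpos[of 10] by (auto simp: \<alpha>_def)
  have \<sigma>: "0 < \<sigma>" by (simp add: \<sigma>_def)
  have \<theta>: "0 < \<theta>" using \<sigma> t by (simp add: \<theta>_def)
  have \<eta>: "0 < \<eta>" using \<sigma> \<alpha> by (simp add: \<eta>_def)
  have tt: "(real t + 1)\<^sup>2 \<le> l\<^sup>2" using t1l by (intro power_mono) auto
  have tt': "real t * (real t + 1) \<le> l\<^sup>2"
    using t1l mult_mono[of "real t" l "real t + 1" l] by (simp add: power2_eq_square)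

  have P: "36 ^ t * l ^ (10 * t) \<le> sqrt n"
  proof -
    have "36 ^ t * l ^ (10 * t) \<le> l ^ t * l ^ (10 * t)"
      using l by (intro mult_right_mono power_mono) auto
    also have "\<dots> = l powr (11 * t)"
      using l by (simp add: powr_realpow[symmetric] flip: power_add powr_add)
    also have "\<dots> = 2 powr (log 2 l * (11 * t))"
      using l by (simp add: powr_powr[symmetric])
    also have "\<dots> \<le> 2 powr (l / 2)"
    proof (rule powr_mono)
      have "0 \<le> t * log 2 l" using logl by simp
      moreover have "log 2 l * real (11 * t) = 11 * (t * log 2 l)" by simp
      ultimately show "log 2 l * real (11 * t) \<le> l / 2" using tlog by linarith
    qed simp
    also have "\<dots> = sqrt n"
      using npow by (simp add: powr_half_sqrt_powr)
    finally show ?thesis .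
  qed
  have sqn: "sqrt n \<le> n"
    using n by (intro real_le_lsqrt) (auto simp: power2_eq_square)
  have "36 ^ t * l ^ 10 \<le> 36 ^ t * l ^ (10 * t)"
    using l t by (intro mult_left_mono power_increasing) auto
  then have "36 ^ t * l ^ 10 \<le> n"
    using P sqn by linarith
  then have c36: "36 ^ t \<le> \<alpha> * n"
    using lpos[of 10] by (simp add: \<alpha>_def field_simps)
  have loss: "t * (2 * \<theta> + \<alpha> * 36) \<le> \<sigma> / 4"
  proof -
    have "288 * (real t * (real t + 1)) \<le> 288 * l\<^sup>2" using tt' by simp
    also have "\<dots> \<le> 36\<^sup>2 * l\<^sup>2" by simp
    also have "\<dots> \<le> l\<^sup>2 * l\<^sup>2" using l by (intro mult_right_mono power_mono) auto
    also have "\<dots> \<le> l ^ 10" using l by (auto simp flip: power_add intro!: power_increasing)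
    finally have "36 * \<alpha> * t \<le> \<sigma> / 8"
      using lpos[of 10] by (simp add: \<alpha>_def \<sigma>_def field_simps)
    moreover have "t * (2 * \<theta>) = \<sigma> / 8" using t by (simp add: \<theta>_def)
    ultimately show ?thesis by (simp add: algebra_simps)
  qed
  have "1 / \<eta> = 144 * (real t + 1) * (36 ^ t * l ^ (10 * t))"
    using l by (simp add: \<eta>_def \<alpha>_def \<sigma>_def power_divide field_simps flip: power_mult)
  also have "\<dots> \<le> 144 * l * sqrt n"
    using t1l P l by (intro mult_mono) auto
  finally have "1 / \<eta> \<le> 144 * l * sqrt n" .
  moreover have "1 \<le> l * sqrt n"
    using l n mult_mono[of 1 l 1 "sqrt n"] by simp
  ultimately have m: "1 / \<eta> \<le> m" "m \<le> 145 * l * sqrt n"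
    using \<eta> by (auto simp: m_def intro: order_trans[OF real_nat_ceiling_ge]) linarith
  have "2 * \<alpha> * 36 * n / \<theta> = 1152 * n / l ^ 10 * (real t * (real t + 1))"
    using t l by (simp add: \<theta>_def \<alpha>_def \<sigma>_def field_simps)
  also have "\<dots> \<le> 1152 * n / l ^ 10 * l\<^sup>2"
    using tt' n l by (intro mult_left_mono) auto
  also have "\<dots> = 1152 * n / l ^ 8"
    using l by (simp add: field_simps flip: power_add)
  finally have "2 * \<alpha> * 36 * n / \<theta> \<le> 1152 * n / l ^ 8" .
  moreover have "0 \<le> 2 * \<alpha> * 36 * n / \<theta>" using \<alpha> \<theta> n by simp
  ultimately have L: "2 * \<alpha> * 36 * n / \<theta> \<le> L" "L \<le> 1152 * n / l ^ 8 + 1"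
    unfolding L_def by linarith+
  have "0 \<le> 331776 * l\<^sup>2" by simp
  then have I: "331776 * l\<^sup>2 \<le> I" "I \<le> 331777 * l\<^sup>2"
    using l1[of 2] unfolding I_def by linarith+
  \<comment> \<open>The constant is \<open>331776 = 16 * 4 * 36 ^ 3 / 9\<close>: the threshold is
    \<open>331776 * (t + 1) ^ 2\<close> times the gain of one round.\<close>
  have I\<rho>: "n\<^sup>2 / (9 * t) \<le> I * ?\<rho>"
  proof -
    have "331776 * (real t + 1)\<^sup>2 \<le> I" using I tt by linarith
    then have "331776 * (real t + 1)\<^sup>2 * ?\<rho> \<le> I * ?\<rho>"
      using \<sigma> \<theta> by (intro mult_right_mono) auto
    moreover have "331776 * (real t + 1)\<^sup>2 * ?\<rho> = n\<^sup>2 / (9 * t)"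
    proof -
      define q where "q = real t + 1"
      have "0 < q" by (simp add: q_def)
      then show ?thesis
        using t(1) unfolding \<theta>_def \<sigma>_def q_def[symmetric] by (simp add: field_simps power2_eq_square)
    qed
    ultimately show ?thesis by simp
  qed
  let ?K = "((card V * 2 ^ card V + 1) ^ m) ^ t * (card V + 1) ^ (L * t * card V)"
  have "72 * t \<le> card V" using nl t1l by (simp add: n_def)
  then have av: "avoidable (\<lambda>R. R \<subseteq> [V]\<^bsup>2\<^esup> \<and> min (n\<^sup>2 / (9 * t)) (I * ?\<rho>) \<le> card R)
      (\<lambda>H. \<not> has_clique V H t) (?K ^ I)"
    using graph_containers_iterate[of V t \<alpha> \<theta> \<eta> L m I, OF fin t(1) _ \<alpha> \<theta> \<eta>]
      L(1) m(1) c36 loss unfolding n_def \<sigma>_def \<eta>_def by simp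
  have "real (?K ^ I) \<le> 2 powr (n\<^sup>2 / l\<^sup>2)"
  proof -
    have "n + 1 \<le> 2 ^ card V"
      using of_nat_mono[OF Suc_leI[OF less_exp[of "card V"]], where 'a = real] by (simp add: n_def)
    then have "n * 2 ^ card V + 1 \<le> 2 ^ card V * 2 ^ card V"
      using n mult_right_mono[of "n + 1" "2 ^ card V" "2 ^ card V"] one_le_power[of "2::real" "card V"]
      by (simp add: algebra_simps)
    also have "\<dots> = 2 powr (2 * n)"
      by (simp add: n_def powr_realpow[symmetric] flip: powr_add)
    finally have X: "n * 2 ^ card V + 1 \<le> 2 powr (2 * n)" .
    have "2 \<le> n" using nl l by linarith
    then have "n + 1 \<le> n * n" using mult_right_mono[of 2 n n] by linarith
    also have "\<dots> = 2 powr (2 * l)" using npow by (simp flip: powr_add)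
    finally have Y: "n + 1 \<le> 2 powr (2 * l)" .
    have "real (?K ^ I) = ((n * 2 ^ card V + 1) ^ (m * t) * (n + 1) ^ (L * t * card V)) ^ I"
      by (simp add: n_def power_mult add.commute)
    also have "\<dots> \<le> ((2 powr (2 * n)) ^ (m * t) * (2 powr (2 * l)) ^ (L * t * card V)) ^ I"
      using X Y n by (intro power_mono mult_mono) auto
    also have "\<dots> = 2 powr ((2 * n * (m * t) + 2 * l * (L * t * n)) * I)"
      by (simp add: n_def powr_power powr_add[symmetric] mult.commute)
    also have "\<dots> \<le> 2 powr (n\<^sup>2 / l\<^sup>2)"
    proof (rule powr_mono)
      have "2 * n * m * t * I \<le> 2 * n * (145 * l * sqrt n) * l * (331777 * l\<^sup>2)"
        using m I t1l n l by (intro mult_mono) auto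
      moreover have "2 * l * L * t * n * I \<le> 2 * l * (1152 * n / l ^ 8 + 1) * l * n * (331777 * l\<^sup>2)"
        using L I t1l n l by (intro mult_mono) auto
      ultimately have "2 * n * m * t * I + 2 * l * L * t * n * I \<le> n\<^sup>2 / (2 * l\<^sup>2) + n\<^sup>2 / (2 * l\<^sup>2)"
        using big1 big2 by linarith
      then show "(2 * n * (m * t) + 2 * l * (L * t * n)) * I \<le> n\<^sup>2 / l\<^sup>2"
        by (simp add: algebra_simps)
    qed simp
    finally show ?thesis .
  qed
  then have K: "?K ^ I \<le> nat \<lfloor>2 powr (n\<^sup>2 / l\<^sup>2)\<rfloor>"
    by (simp add: le_nat_floor)
  show ?thesis
  proof (rule avoidable_mono[OF av _ _ K])
    fix R assume "R \<subseteq> [V]\<^bsup>2\<^esup> \<and> min (n\<^sup>2 / (9 * t)) (I * ?\<rho>) \<le> card R"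
    then show "R \<subseteq> [V]\<^bsup>2\<^esup> \<and> n\<^sup>2 / (9 * t) \<le> card R"
      using I\<rho> unfolding min_le_iff_disj by linarith
  qed assumption
qed

text \<open>The last two left sides are of order \<open>n powr (3 / 2) * l ^ 4\<close> and
  \<open>n ^ 2 / l ^ 4\<close>; they bound the two contributions to the exponent of the number of
  containers.\<close>

lemma eventually_large:
  "\<forall>\<^sub>F n :: nat in sequentially. let l = log 2 (real n) in 36 \<le> l \<and> 72 * l \<le> n \<and> l\<^sup>2 \<le> n \<and>
    2 * n * (145 * l * sqrt n) * l * (331777 * l\<^sup>2) \<le> n\<^sup>2 / (2 * l\<^sup>2) \<and>
    2 * l * (1152 * n / l ^ 8 + 1) * l * n * (331777 * l\<^sup>2) \<le> n\<^sup>2 / (2 * l\<^sup>2)"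
  unfolding Let_def by (intro eventually_conj; real_asymp)

section \<open>Random graphs\<close>

lemma sum_UN_le:
  fixes f :: "'b \<Rightarrow> real"
  assumes "finite I" "\<And>i. i \<in> I \<Longrightarrow> finite (A i)" "\<And>x. 0 \<le> f x"
  shows "(\<Sum>x\<in>(\<Union>i\<in>I. A i). f x) \<le> (\<Sum>i\<in>I. \<Sum>x\<in>A i. f x)"
  using assms(1,2)
proof (induction I)
  case (insert i I)
  have "(\<Sum>x\<in>A i \<union> (\<Union>i\<in>I. A i). f x) \<le> (\<Sum>x\<in>A i. f x) + (\<Sum>x\<in>(\<Union>i\<in>I. A i). f x)"
    using insert assms(3) by (subst sum_Un) (auto intro!: sum_nonneg)
  with insert show ?case by force
qed simp

text \<open>The probability of \<open>E\<close> when the elements of \<open>U\<close> are chosen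
  independently with probability \<open>p\<close>; finite sums replace a probability space.\<close>

definition graph_weight :: "real \<Rightarrow> 'e set \<Rightarrow> 'e set \<Rightarrow> real"
  where "graph_weight p U E = p ^ card E * (1 - p) ^ card (U - E)"

lemma sum_graph_weight:
  assumes "finite U"
  shows "(\<Sum>E\<in>Pow U. graph_weight p U E) = 1"
proof -
  have "(\<Prod>e\<in>U. p + (1 - p)) = (\<Sum>E\<in>Pow U. (\<Prod>e\<in>E. p) * (\<Prod>e\<in>U - E. 1 - p))"
    using assms by (rule prod_add)
  then show ?thesis by (simp add: graph_weight_def)
qed

lemma sum_graph_weight_disjoint:
  assumes "finite U" "M \<subseteq> U"
  shows "(\<Sum>E | E \<subseteq> U \<and> M \<inter> E = {}. graph_weight p U E) = (1 - p) ^ card M"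
proof -
  have "{E. E \<subseteq> U \<and> M \<inter> E = {}} = Pow (U - M)" by auto
  moreover have "graph_weight p U E = (1 - p) ^ card M * graph_weight p (U - M) E"
    if "E \<in> Pow (U - M)" for E
  proof -
    have "U - E = M \<union> (U - M - E)" "M \<inter> (U - M - E) = {}" using assms that by auto
    then have "card (U - E) = card M + card (U - M - E)"
      using assms finite_subset by (metis card_Un_disjoint finite_Diff)
    then show ?thesis by (simp add: graph_weight_def power_add)
  qed
  ultimately have "(\<Sum>E | E \<subseteq> U \<and> M \<inter> E = {}. graph_weight p U E)
      = (1 - p) ^ card M * (\<Sum>E\<in>Pow (U - M). graph_weight p (U - M) E)"
    by (simp add: sum_distrib_left)
  then show ?thesis using assms sum_graph_weight[of "U - M" p] by simp
qed

text \<open>Complementation exchanges \<open>p\<close> and \<open>1 - p\<close>.\<close>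

lemma sum_graph_weight_superset:
  assumes "finite U" "M \<subseteq> U"
  shows "(\<Sum>E | E \<subseteq> U \<and> M \<subseteq> E. graph_weight p U E) = p ^ card M"
proof -
  have "bij_betw (\<lambda>E. U - E) {E. E \<subseteq> U \<and> M \<inter> E = {}} {E. E \<subseteq> U \<and> M \<subseteq> E}"
    using assms(2) by (intro bij_betwI[of _ _ _ "\<lambda>E. U - E"]) auto
  then have "(\<Sum>E | E \<subseteq> U \<and> M \<subseteq> E. graph_weight p U E)
      = (\<Sum>E | E \<subseteq> U \<and> M \<inter> E = {}. graph_weight p U (U - E))"
    by (simp add: sum.reindex_bij_betw)
  also have "\<dots> = (\<Sum>E | E \<subseteq> U \<and> M \<inter> E = {}. graph_weight (1 - p) U E)"
    by (intro sum.cong) (auto simp: graph_weight_def double_diff)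
  finally show ?thesis using sum_graph_weight_disjoint[OF assms, of "1 - p"] by simp
qed

text \<open>Union bound: if every \<open>E\<close> failed, the bad events would cover
  \<open>Pow U\<close>, which has total weight 1.\<close>

lemma ex_graph_hitting:
  fixes p a b :: real
  assumes U: "finite U" and p: "0 < p" "p < 1"
    and \<A>: "finite \<A>" "\<And>M. M \<in> \<A> \<Longrightarrow> M \<subseteq> U \<and> a \<le> card M"
    and \<B>: "finite \<B>" "\<And>M. M \<in> \<B> \<Longrightarrow> M \<subseteq> U \<and> b \<le> card M"
    and small: "card \<A> * (1 - p) powr a + card \<B> * p powr b < 1"
  shows "\<exists>E\<subseteq>U. (\<forall>M\<in>\<A>. M \<inter> E \<noteq> {}) \<and> (\<forall>M\<in>\<B>. \<not> M \<subseteq> E)"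
proof (rule ccontr)
  assume contra: "\<not> ?thesis"
  let ?D = "\<lambda>M. {E. E \<subseteq> U \<and> M \<inter> E = {}}" and ?S = "\<lambda>M. {E. E \<subseteq> U \<and> M \<subseteq> E}"
  let ?W = "graph_weight p U"
  have fin: "finite (?D M)" "finite (?S M)" for M using U by auto
  have nonneg: "0 \<le> ?W E" for E using p by (simp add: graph_weight_def)
  have "1 = (\<Sum>E\<in>Pow U. ?W E)" using U by (simp add: sum_graph_weight)
  also have "\<dots> \<le> (\<Sum>E\<in>(\<Union>M\<in>\<A>. ?D M) \<union> (\<Union>M\<in>\<B>. ?S M). ?W E)"
    using contra fin \<A>(1) \<B>(1) nonneg by (intro sum_mono2) auto
  also have "\<dots> \<le> (\<Sum>E\<in>(\<Union>M\<in>\<A>. ?D M). ?W E) + (\<Sum>E\<in>(\<Union>M\<in>\<B>. ?S M). ?W E)"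
    using fin \<A>(1) \<B>(1) nonneg by (subst sum_Un) (auto intro!: sum_nonneg)
  also have "(\<Sum>E\<in>(\<Union>M\<in>\<A>. ?D M). ?W E) \<le> (\<Sum>M\<in>\<A>. \<Sum>E\<in>?D M. ?W E)"
    using sum_UN_le[OF \<A>(1), of ?D ?W] fin nonneg by simp
  also have "\<dots> \<le> (\<Sum>M\<in>\<A>. (1 - p) powr a)"
  proof (rule sum_mono)
    fix M assume M: "M \<in> \<A>"
    have "(\<Sum>E\<in>?D M. ?W E) = (1 - p) powr card M"
      using sum_graph_weight_disjoint[OF U, of M p] \<A>(2)[OF M] p by (simp add: powr_realpow)
    also have "\<dots> \<le> (1 - p) powr a"
      using \<A>(2)[OF M] p by (intro powr_mono') auto
    finally show "(\<Sum>E\<in>?D M. ?W E) \<le> (1 - p) powr a" .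
  qed
  also have "(\<Sum>E\<in>(\<Union>M\<in>\<B>. ?S M). ?W E) \<le> (\<Sum>M\<in>\<B>. \<Sum>E\<in>?S M. ?W E)"
    using sum_UN_le[OF \<B>(1), of ?S ?W] fin nonneg by simp
  also have "\<dots> \<le> (\<Sum>M\<in>\<B>. p powr b)"
  proof (rule sum_mono)
    fix M assume M: "M \<in> \<B>"
    have "(\<Sum>E\<in>?S M. ?W E) = p powr card M"
      using sum_graph_weight_superset[OF U, of M p] \<B>(2)[OF M] p by (simp add: powr_realpow)
    also have "\<dots> \<le> p powr b"
      using \<B>(2)[OF M] p by (intro powr_mono') auto
    finally show "(\<Sum>E\<in>?S M. ?W E) \<le> p powr b" .
  qed
  finally show False using small by simp
qed

text \<open>Collect the missing sets of the containers for all \<open>n\<close>-sets. A graph that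
  meets those of the first family has an \<open>s\<close>-clique in each \<open>n\<close>-set; if it
  contains none of the second family, its complement meets them all and has a
  \<open>t\<close>-clique in each \<open>n\<close>-set.\<close>

lemma not_all_graphs_have_good_setI:
  fixes p a b :: real and B :: nat
  assumes p: "0 < p" "p < 1"
    and cliq: "\<And>A :: nat set. finite A \<Longrightarrow> card A = n \<Longrightarrow>
      avoidable (\<lambda>M. M \<subseteq> [A]\<^bsup>2\<^esup> \<and> a \<le> card M) (\<lambda>H. \<not> has_clique A H s) B"
    and ind: "\<And>A :: nat set. finite A \<Longrightarrow> card A = n \<Longrightarrow>
      avoidable (\<lambda>M. M \<subseteq> [A]\<^bsup>2\<^esup> \<and> b \<le> card M) (\<lambda>H. \<not> has_clique A H t) B"
    and small: "real N ^ n * B * ((1 - p) powr a + p powr b) < 1"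
  shows "\<not> all_graphs_have_good_set N n s t"
proof -
  let ?V = "{..<N}"
  let ?U = "[?V]\<^bsup>2\<^esup>"
  have U: "finite ?U" by (simp add: finite_imp_finite_nsets)
  have A: "finite A" "card A = n" "[A]\<^bsup>2\<^esup> \<subseteq> ?U" if "A \<in> [?V]\<^bsup>n\<^esup>" for A
    using that nsets_mono[of A ?V 2] by (auto simp: nsets_def)
  have finVn: "finite ([?V]\<^bsup>n\<^esup>)" by (simp add: finite_imp_finite_nsets)
  have "card ([?V]\<^bsup>n\<^esup>) \<le> N ^ n"
    using binomial_le_pow[of n N] by (cases "n \<le> N") (auto simp: binomial_eq_0)
  have family: "\<exists>\<F>. finite \<F> \<and> card \<F> \<le> N ^ n * B \<and> (\<forall>M\<in>\<F>. M \<subseteq> ?U \<and> c \<le> card M) \<and>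
      (\<forall>A\<in>[?V]\<^bsup>n\<^esup>. \<forall>H. \<not> has_clique A H r \<longrightarrow> (\<exists>M\<in>\<F>. M \<subseteq> [A]\<^bsup>2\<^esup> \<and> M \<inter> H = {}))"
    if av: "\<And>A :: nat set. finite A \<Longrightarrow> card A = n \<Longrightarrow>
      avoidable (\<lambda>M. M \<subseteq> [A]\<^bsup>2\<^esup> \<and> c \<le> card M) (\<lambda>H. \<not> has_clique A H r) B" for c :: real and r
  proof -
    have "\<forall>A\<in>[?V]\<^bsup>n\<^esup>. \<exists>\<R>. finite \<R> \<and> card \<R> \<le> B \<and> (\<forall>M\<in>\<R>. M \<subseteq> [A]\<^bsup>2\<^esup> \<and> c \<le> card M) \<and>
        (\<forall>H. \<not> has_clique A H r \<longrightarrow> (\<exists>M\<in>\<R>. M \<inter> H = {}))"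
    proof
      fix A assume "A \<in> [?V]\<^bsup>n\<^esup>"
      from av[OF A(1)[OF this] A(2)[OF this]]
      show "\<exists>\<R>. finite \<R> \<and> card \<R> \<le> B \<and> (\<forall>M\<in>\<R>. M \<subseteq> [A]\<^bsup>2\<^esup> \<and> c \<le> card M) \<and>
        (\<forall>H. \<not> has_clique A H r \<longrightarrow> (\<exists>M\<in>\<R>. M \<inter> H = {}))"
        unfolding avoidable_def .
    qed
    from bchoice[OF this] obtain \<R> where \<R>: "\<forall>A\<in>[?V]\<^bsup>n\<^esup>. finite (\<R> A) \<and> card (\<R> A) \<le> B \<and>
        (\<forall>M\<in>\<R> A. M \<subseteq> [A]\<^bsup>2\<^esup> \<and> c \<le> card M) \<and>
        (\<forall>H. \<not> has_clique A H r \<longrightarrow> (\<exists>M\<in>\<R> A. M \<inter> H = {}))"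
      by (elim exE)
    have "card (\<Union>A\<in>[?V]\<^bsup>n\<^esup>. \<R> A) \<le> (\<Sum>A\<in>[?V]\<^bsup>n\<^esup>. card (\<R> A))"
      using finVn by (rule card_UN_le)
    also have "\<dots> \<le> (\<Sum>A\<in>[?V]\<^bsup>n\<^esup>. B)"
      using \<R> by (intro sum_mono) auto
    also have "\<dots> \<le> N ^ n * B"
      using \<open>card ([?V]\<^bsup>n\<^esup>) \<le> N ^ n\<close> by simp
    finally have "card (\<Union>A\<in>[?V]\<^bsup>n\<^esup>. \<R> A) \<le> N ^ n * B" .
    moreover have "finite (\<Union>A\<in>[?V]\<^bsup>n\<^esup>. \<R> A)" using \<R> finVn by blast
    moreover have "\<forall>M\<in>(\<Union>A\<in>[?V]\<^bsup>n\<^esup>. \<R> A). M \<subseteq> ?U \<and> c \<le> card M"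
      using \<R> A(3) by (meson UN_E subset_trans)
    moreover have "\<exists>M\<in>(\<Union>A\<in>[?V]\<^bsup>n\<^esup>. \<R> A). M \<subseteq> [A]\<^bsup>2\<^esup> \<and> M \<inter> H = {}"
      if "A \<in> [?V]\<^bsup>n\<^esup>" "\<not> has_clique A H r" for A H
      using bspec[OF \<R> that(1)] that by (meson UN_I)
    ultimately show ?thesis by (intro exI[of _ "\<Union>A\<in>[?V]\<^bsup>n\<^esup>. \<R> A"]) simp
  qed
  from family[of a s] cliq obtain \<A> where \<A>: "finite \<A>" "card \<A> \<le> N ^ n * B"
    "\<And>M. M \<in> \<A> \<Longrightarrow> M \<subseteq> ?U \<and> a \<le> card M"
    "\<And>A H. A \<in> [?V]\<^bsup>n\<^esup> \<Longrightarrow> \<not> has_clique A H s \<Longrightarrow> \<exists>M\<in>\<A>. M \<subseteq> [A]\<^bsup>2\<^esup> \<and> M \<inter> H = {}"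
    by auto
  from family[of b t] ind obtain \<B> where \<B>: "finite \<B>" "card \<B> \<le> N ^ n * B"
    "\<And>M. M \<in> \<B> \<Longrightarrow> M \<subseteq> ?U \<and> b \<le> card M"
    "\<And>A H. A \<in> [?V]\<^bsup>n\<^esup> \<Longrightarrow> \<not> has_clique A H t \<Longrightarrow> \<exists>M\<in>\<B>. M \<subseteq> [A]\<^bsup>2\<^esup> \<and> M \<inter> H = {}"
    by auto
  have "real (card \<A>) * (1 - p) powr a + real (card \<B>) * p powr b
      \<le> real (N ^ n * B) * (1 - p) powr a + real (N ^ n * B) * p powr b"
    using \<A>(2) \<B>(2) by (intro add_mono mult_right_mono) (auto simp only: of_nat_le_iff powr_ge_zero)
  also have "\<dots> = real N ^ n * B * ((1 - p) powr a + p powr b)"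
    by (simp add: algebra_simps)
  finally have "real (card \<A>) * (1 - p) powr a + real (card \<B>) * p powr b < 1"
    using small by linarith
  from ex_graph_hitting[OF U p \<A>(1,3) \<B>(1,3) this] obtain E where E: "E \<subseteq> ?U"
    "\<forall>M\<in>\<A>. M \<inter> E \<noteq> {}" "\<forall>M\<in>\<B>. \<not> M \<subseteq> E" by auto
  have "has_clique A E s \<and> has_indep A E t" if AV: "A \<in> [?V]\<^bsup>n\<^esup>" for A
  proof
    show "has_clique A E s" using \<A>(4)[OF AV] E(2) by blast
    have "has_clique A ([A]\<^bsup>2\<^esup> - E) t"
    proof (rule ccontr)
      assume "\<not> ?thesis"
      from \<B>(4)[OF AV this] obtain M where "M \<in> \<B>" "M \<subseteq> [A]\<^bsup>2\<^esup>" "M \<inter> ([A]\<^bsup>2\<^esup> - E) = {}" by blast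
      with E(3) show False by blast
    qed
    then show "has_indep A E t"
      unfolding has_clique_def has_indep_def clique_def indep_def by blast
  qed
  then show ?thesis
    unfolding all_graphs_have_good_set_def using E(1) by (intro notI) (auto dest!: spec[of _ ?V])
qed

text \<open>
  With \<open>u = t / s \<ge> 1\<close> and \<open>p = u powr (- 1 / 3) / 2\<close> both estimates follow from
  \<open>u powr (2 / 3) \<ge> 1 + 2 / 3 * ln u\<close>, and the constants leave room because the containers miss
  \<open>n\<^sup>2 / (9 * t)\<close> pairs: \<open>(1 + ln 2) / 32\<close> is below both \<open>1 / 18\<close> and \<open>ln 2 / 9\<close>, and
  \<open>1 / 32 < 1 / 27\<close>.
\<close>

lemma random_graph_exponents:
  fixes s t :: nat
  defines "X \<equiv> ln (2 * exp 1 * real t / real s)" and "p \<equiv> (real s / real t) powr (1 / 3) / 2"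
  assumes st: "1 \<le> s" "s \<le> t"
  shows "0 < p" "p < 1"
    "X / 32 / t + ln (1 - p) / (9 * s) \<le> - 1 / (400 * t)"
    "X / 32 / t + ln p / (9 * t) \<le> - 1 / (400 * t)"
proof -
  define u where "u = real t / real s"
  have u: "1 \<le> u" using st by (simp add: u_def)
  have p: "p = u powr (- 1 / 3) / 2"
    using st by (simp add: p_def u_def powr_divide powr_minus_divide)
  have "u powr (- 1 / 3) \<le> u powr 0" using u by (intro powr_mono) auto
  then have "p \<le> 1 / 2" using u by (simp add: p)
  then show p01: "0 < p" "p < 1" using u by (auto simp: p)
  have X: "X = ln 2 + 1 + ln u"
    using st unfolding X_def u_def by (simp add: ln_mult ln_div)
  have lnu: "0 \<le> ln u" using u by simp
  have "u powr (2 / 3) = exp (2 / 3 * ln u)" using u by (simp add: powr_def)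
  then have u23: "1 + 2 / 3 * ln u \<le> u powr (2 / 3)" using exp_ge_add_one_self by simp
  have up: "u * p = u powr (2 / 3) / 2"
    using u powr_add[of u 1 "- 1 / 3"] by (simp add: p)
  have "ln (1 - p) \<le> - p" using p01 ln_add_one_self_le_self2[of "- p"] by simp
  then have "ln (1 - p) / (9 * s) \<le> - p / (9 * s)" by (intro divide_right_mono) auto
  also have "\<dots> = - (u * p) / 9 / t" using st by (simp add: u_def)
  finally have "X / 32 / t + ln (1 - p) / (9 * s) \<le> (X / 32 - u * p / 9) / t"
    by (simp add: diff_divide_distrib)
  also have "\<dots> \<le> (- 1 / 400) / t"
  proof (rule divide_right_mono)
    \<comment> \<open>With \<open>ln 2 \<le> 25 / 36\<close> the constant terms sum to at most
      \<open>61 / 1152 - 64 / 1152 = - 1 / 384\<close>, which dictates the slack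
      \<open>1 / 400\<close>.\<close>
    show "X / 32 - u * p / 9 \<le> - 1 / 400"
      using X up u23 lnu ln2_le_25_over_36 by linarith
  qed simp
  finally show "X / 32 / t + ln (1 - p) / (9 * s) \<le> - 1 / (400 * t)" by simp
  have lnp: "ln p = - (ln u / 3) - ln 2" using u by (simp add: p ln_div ln_powr)
  have "X / 32 / t + ln p / (9 * t) = (X / 32 + ln p / 9) / t"
    by (simp add: add_divide_distrib)
  also have "\<dots> \<le> (- 1 / 400) / t"
  proof (rule divide_right_mono)
    show "X / 32 + ln p / 9 \<le> - 1 / 400"
      using X lnp lnu ln2_le_25_over_36 ln2_ge_two_thirds by linarith
  qed simp
  finally show "X / 32 / t + ln p / (9 * t) \<le> - 1 / (400 * t)" by simp
qed

text \<open>Arguing by contradiction with \<open>N = g n s t\<close> itself avoids rounding the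
  bound and any monotonicity in \<open>N\<close>.\<close>

lemma g_lower_bound:
  fixes n s t :: nat and l :: real
  defines "l \<equiv> log 2 (real n)"
  assumes st: "2 \<le> s" "s \<le> t" and t: "t \<le> l / (120 * log 2 l)"
    and l: "36 \<le> l" and nl: "72 * l \<le> n"
    and big1: "2 * n * (145 * l * sqrt n) * l * (331777 * l\<^sup>2) \<le> n\<^sup>2 / (2 * l\<^sup>2)"
    and big2: "2 * l * (1152 * n / l ^ 8 + 1) * l * n * (331777 * l\<^sup>2) \<le> n\<^sup>2 / (2 * l\<^sup>2)"
  shows "2 powr (real n / (32 * real t) * log 2 (2 * exp 1 * real t / real s)) \<le> real (g n s t)"
proof (rule ccontr)
  define X where "X = ln (2 * exp 1 * real t / real s)"
  define p where "p = (real s / real t) powr (1 / 3) / 2"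
  define N where "N = g n s t"
  let ?B = "nat \<lfloor>2 powr ((real n)\<^sup>2 / l\<^sup>2)\<rfloor>"
  have t0: "0 < real t" using st by simp
  have logl: "1 \<le> log 2 l" using l by (simp add: le_log_iff)
  have sl: "s \<le> l / (120 * log 2 l)" using st t by linarith
  assume "\<not> 2 powr (real n / (32 * real t) * log 2 (2 * exp 1 * real t / real s)) \<le> real (g n s t)"
  then have "real N \<le> 2 powr (real n / (32 * real t) * log 2 (2 * exp 1 * real t / real s))"
    by (simp add: N_def)
  also have "\<dots> = exp (n * (X / 32 / t))"
    by (simp add: powr_def log_def X_def)
  finally have "real N ^ n \<le> exp (n * (X / 32 / t)) ^ n" by (intro power_mono) auto
  also have "\<dots> = exp (n\<^sup>2 * (X / 32 / t))"
    by (simp add: exp_of_nat_mult[symmetric] power2_eq_square)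
  finally have Nn: "real N ^ n \<le> exp (n\<^sup>2 * (X / 32 / t))" .
  have "real ?B \<le> 2 powr ((real n)\<^sup>2 / l\<^sup>2)" by simp
  also have "\<dots> = exp (n\<^sup>2 * (ln 2 / l\<^sup>2))" by (simp add: powr_def mult.commute)
  finally have B: "real ?B \<le> exp (n\<^sup>2 * (ln 2 / l\<^sup>2))" .
  have "real t * 120 \<le> t * (120 * log 2 l)" using logl by (intro mult_left_mono) auto
  also have "\<dots> \<le> l" using t logl by (simp add: field_simps)
  finally have t120: "real t * 120 \<le> l" .
  \<comment> \<open>The containers cost \<open>ln 2 / l\<^sup>2\<close>, at most
    \<open>1 / (36 * l)\<close>, while the slack \<open>1 / (400 * t)\<close> is at least
    \<open>3 / (10 * l)\<close>.\<close>
  have gap: "n\<^sup>2 * (ln 2 / l\<^sup>2) - n\<^sup>2 / (400 * t) \<le> - 2"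
  proof -
    have "ln 2 / l\<^sup>2 \<le> 1 / (36 * l)"
    proof -
      have "ln 2 / l\<^sup>2 \<le> 1 / l\<^sup>2" using l ln2_le_25_over_36 by (intro divide_right_mono) auto
      also have "\<dots> \<le> 1 / (36 * l)"
        using l by (intro divide_left_mono) (auto simp: power2_eq_square)
      finally show ?thesis .
    qed
    moreover have "3 / (10 * l) \<le> 1 / (400 * t)" using t120 t0 l by (simp add: field_simps)
    moreover have "1 / (36 * l) - 3 / (10 * l) = - 49 / (180 * l)" using l by (simp add: field_simps)
    ultimately have "ln 2 / l\<^sup>2 - 1 / (400 * t) \<le> - 49 / (180 * l)" by linarith
    then have "n\<^sup>2 * (ln 2 / l\<^sup>2 - 1 / (400 * t)) \<le> n\<^sup>2 * (- 49 / (180 * l))"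
      by (intro mult_left_mono) auto
    also have "\<dots> \<le> - 2"
    proof -
      have "72 * l * (72 * l) \<le> real n * real n" using nl l by (intro mult_mono) auto
      moreover have "72 * l * 72 \<le> 72 * l * (72 * l)" using l by (intro mult_left_mono) auto
      ultimately have "360 * l \<le> 49 * (real n * real n)" using l by linarith
      then show ?thesis using l by (simp add: field_simps power2_eq_square)
    qed
    finally show ?thesis by (simp add: right_diff_distrib)
  qed
  note ex = random_graph_exponents[of s t, folded X_def p_def]
  have p: "0 < p" "p < 1" using ex(1,2) st by auto
  \<comment> \<open>Covers both terms of the union bound; two thirds is below 1.\<close>
  have summand: "real N ^ n * ?B * exp (n\<^sup>2 * y) \<le> 1 / 3" if y: "X / 32 / t + y \<le> - 1 / (400 * t)" for y :: real
  proof -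
    have "real N ^ n * ?B * exp (n\<^sup>2 * y)
        \<le> exp (n\<^sup>2 * (X / 32 / t)) * exp (n\<^sup>2 * (ln 2 / l\<^sup>2)) * exp (n\<^sup>2 * y)"
      using Nn B by (intro mult_mono) auto
    also have "\<dots> = exp (n\<^sup>2 * (X / 32 / t + y) + n\<^sup>2 * (ln 2 / l\<^sup>2))"
      by (simp add: exp_add[symmetric] algebra_simps)
    also have "\<dots> \<le> exp (- 2)"
    proof (subst exp_le_cancel_iff)
      have "n\<^sup>2 * (X / 32 / t + y) \<le> n\<^sup>2 * (- 1 / (400 * t))" using y by (intro mult_left_mono) auto
      then show "n\<^sup>2 * (X / 32 / t + y) + n\<^sup>2 * (ln 2 / l\<^sup>2) \<le> - 2" using gap by simp
    qed
    also have "\<dots> \<le> 1 / 3"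
      using exp_ge_add_one_self[of 2] by (simp add: exp_minus field_simps)
    finally show ?thesis .
  qed
  have "\<not> all_graphs_have_good_set N n s t"
  proof (rule not_all_graphs_have_good_setI[OF p])
    show "avoidable (\<lambda>M. M \<subseteq> [A]\<^bsup>2\<^esup> \<and> (real n)\<^sup>2 / (9 * s) \<le> card M) (\<lambda>H. \<not> has_clique A H s) ?B"
      if "finite A" "card A = n" for A :: "nat set"
      using graph_containers[of A s] that sl st l nl big1 big2 by (simp add: l_def)
    show "avoidable (\<lambda>M. M \<subseteq> [A]\<^bsup>2\<^esup> \<and> (real n)\<^sup>2 / (9 * t) \<le> card M) (\<lambda>H. \<not> has_clique A H t) ?B"
      if "finite A" "card A = n" for A :: "nat set"
      using graph_containers[of A t] that t st l nl big1 big2 by (simp add: l_def)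
    have "(1 - p) powr ((real n)\<^sup>2 / (9 * s)) = exp (n\<^sup>2 * (ln (1 - p) / (9 * s)))"
      "p powr ((real n)\<^sup>2 / (9 * t)) = exp (n\<^sup>2 * (ln p / (9 * t)))"
      using p by (simp_all add: powr_def)
    then show "real N ^ n * ?B * ((1 - p) powr ((real n)\<^sup>2 / (9 * s)) + p powr ((real n)\<^sup>2 / (9 * t))) < 1"
      using summand[OF ex(3)] summand[OF ex(4)] st by (simp add: distrib_left)
  qed
  then show False
    unfolding N_def using all_graphs_have_good_set_g[of s t n] st by simp
qed

section \<open>The upper bound\<close>

text \<open>By Pascal's rule the neighbours or the non-neighbours of a vertex \<open>v\<close>
  suffice for the induction, and \<open>v\<close> enlarges the structure found there if
  necessary.\<close>

lemma erdos_szekeres_ramsey: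
  fixes V :: "'a set"
  assumes "finite V" "(a + b) choose a \<le> card V"
  shows "\<exists>R\<subseteq>V. card R = a \<and> clique R E \<or> card R = b \<and> indep R E"
  using assms
proof (induction "a + b" arbitrary: a b V)
  case 0
  then show ?case by (intro exI[of _ "{}"]) auto
next
  case (Suc k)
  show ?case
  proof (cases "a = 0 \<or> b = 0")
    case True
    then show ?thesis by (intro exI[of _ "{}"]) auto
  next
    case False
    then obtain a' b' where ab: "a = Suc a'" "b = Suc b'" by (meson not0_implies_Suc)
    have "0 < card V" using Suc.prems zero_less_binomial[of a "a + b"] by linarith
    then obtain v where v: "v \<in> V" by (cases "V = {}") auto
    let ?C = "{w \<in> V - {v}. {v, w} \<in> E}" and ?I = "{w \<in> V - {v}. {v, w} \<notin> E}"
    have fin: "finite ?C" "finite ?I" using Suc.prems by auto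
    have "card V = Suc (card (V - {v}))"
      using Suc.prems v by (metis card_Suc_Diff1)
    also have "V - {v} = ?C \<union> ?I" by auto
    also have "card (?C \<union> ?I) = card ?C + card ?I"
      using fin by (intro card_Un_disjoint) auto
    finally have "card V = Suc (card ?C + card ?I)" .
    moreover have "(a + b) choose a = ((a' + b) choose a') + ((a + b') choose a)"
      by (simp add: ab)
    ultimately consider "(a' + b) choose a' \<le> card ?C" | "(a + b') choose a \<le> card ?I"
      using Suc.prems(2) by linarith
    then show ?thesis
    proof cases
      case 1
      from Suc.hyps(1)[OF _ fin(1) this] obtain R where R: "R \<subseteq> ?C"
        "card R = a' \<and> clique R E \<or> card R = b \<and> indep R E"
        using Suc.hyps(2) ab by auto
      show ?thesis
        using R(2)
      proof
        assume cl: "card R = a' \<and> clique R E"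
        have "finite R" "v \<notin> R" using R(1) fin finite_subset by auto
        then have "card (insert v R) = a" using cl ab by simp
        moreover have "clique (insert v R) E"
          using cl R(1) by (auto simp: clique_def insert_commute)
        ultimately show ?thesis
          using v R(1) by (intro exI[of _ "insert v R"]) auto
      qed (use R(1) in auto)
    next
      case 2
      from Suc.hyps(1)[OF _ fin(2) this] obtain R where R: "R \<subseteq> ?I"
        "card R = a \<and> clique R E \<or> card R = b' \<and> indep R E"
        using Suc.hyps(2) ab by auto
      show ?thesis
        using R(2)
      proof
        assume ind: "card R = b' \<and> indep R E"
        have "finite R" "v \<notin> R" using R(1) fin finite_subset by auto
        then have "card (insert v R) = b" using ind ab by simp
        moreover have "indep (insert v R) E"
          using ind R(1) by (auto simp: indep_def insert_commute)
        ultimately show ?thesis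
          using v R(1) by (intro exI[of _ "insert v R"]) auto
      qed (use R(1) in auto)
    qed
  qed
qed

lemma has_clique_mono: "has_clique A E k \<Longrightarrow> A \<subseteq> B \<Longrightarrow> has_clique B E k"
  unfolding has_clique_def using nsets_mono by blast

lemma has_indep_mono: "has_indep A E k \<Longrightarrow> A \<subseteq> B \<Longrightarrow> has_indep B E k"
  unfolding has_indep_def using nsets_mono by blast

text \<open>An independent set meets a clique in at most one vertex.\<close>

lemma has_indep_Un_clique:
  assumes "has_indep (A \<union> K) E (Suc k)" "clique K E"
  shows "has_indep A E k"
proof -
  obtain I where I: "I \<subseteq> A \<union> K" "finite I" "card I = Suc k" "indep I E"
    using assms(1) by (auto simp: has_indep_def nsets_def)
  have "x = y" if "x \<in> I \<inter> K" "y \<in> I \<inter> K" for x y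
    using that I(4) assms(2) unfolding clique_def indep_def by blast
  then have "card (I \<inter> K) \<le> Suc 0" using I(2) by (simp add: card_le_Suc0_iff_eq)
  moreover have "card I = card (I \<inter> K) + card (I - K)"
    using I(2) by (simp add: card_Int_Diff)
  ultimately have "k \<le> card (I - K)" using I(3) by linarith
  then obtain J where J: "J \<subseteq> I - K" "card J = k" "finite J"
    by (meson obtain_subset_with_card_n)
  then show ?thesis
    unfolding has_indep_def using I smaller_indep[of I E J]
    by (intro bexI[of _ J]) (auto simp: nsets_def)
qed

lemma has_clique_Un_indep:
  assumes "has_clique (A \<union> K) E (Suc k)" "indep K E"
  shows "has_clique A E k"
proof -
  obtain I where I: "I \<subseteq> A \<union> K" "finite I" "card I = Suc k" "clique I E"
    using assms(1) by (auto simp: has_clique_def nsets_def)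
  have "x = y" if "x \<in> I \<inter> K" "y \<in> I \<inter> K" for x y
    using that I(4) assms(2) unfolding clique_def indep_def by blast
  then have "card (I \<inter> K) \<le> Suc 0" using I(2) by (simp add: card_le_Suc0_iff_eq)
  moreover have "card I = card (I \<inter> K) + card (I - K)"
    using I(2) by (simp add: card_Int_Diff)
  ultimately have "k \<le> card (I - K)" using I(3) by linarith
  then obtain J where J: "J \<subseteq> I - K" "card J = k" "finite J"
    by (meson obtain_subset_with_card_n)
  then show ?thesis
    unfolding has_clique_def using I smaller_clique[of I E J]
    by (intro bexI[of _ J]) (auto simp: nsets_def)
qed

text \<open>Removing a clique lowers \<open>i\<close>, removing an independent set lowers
  \<open>j\<close>; the reserve \<open>i * a + j * b\<close> keeps enough vertices for the next
  application of Ramsey's theorem.\<close>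

lemma ex_union_of_cliques_or_indeps:
  fixes V :: "'a set"
  assumes "finite V" "((a + b) choose a) + i * a + j * b \<le> card V"
  shows "(\<exists>A\<subseteq>V. card A = i * a \<and> \<not> has_indep A E (Suc i)) \<or>
    (\<exists>A\<subseteq>V. card A = j * b \<and> \<not> has_clique A E (Suc j))"
  using assms
proof (induction "i + j" arbitrary: i j V)
  case 0
  then show ?case
    by (intro disjI1 exI[of _ "{}"]) (auto simp: has_indep_def nsets_def)
next
  case (Suc k)
  show ?case
  proof (cases "i = 0 \<or> j = 0")
    case True
    have "\<not> has_indep {} E (Suc 0)" "\<not> has_clique {} E (Suc 0)"
      by (auto simp: has_indep_def has_clique_def nsets_def)
    with True show ?thesis by (metis card.empty empty_subsetI mult_0)
  next
    case False
    then obtain i' j' where ij: "i = Suc i'" "j = Suc j'" by (meson not0_implies_Suc)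
    obtain K where K: "K \<subseteq> V" "card K = a \<and> clique K E \<or> card K = b \<and> indep K E"
      using erdos_szekeres_ramsey[of V a b E] Suc.prems by auto
    have finK: "finite K" using K Suc.prems finite_subset by auto
    have cardVK: "card (V - K) = card V - card K"
      using K finK by (simp add: card_Diff_subset)
    show ?thesis
      using K(2)
    proof
      assume cl: "card K = a \<and> clique K E"
      have "((a + b) choose a) + i' * a + j * b \<le> card (V - K)"
        using Suc.prems cl cardVK ij by simp
      with Suc.hyps(1)[of i' j "V - K"] Suc.hyps(2) Suc.prems ij
      consider A where "A \<subseteq> V - K" "card A = i' * a" "\<not> has_indep A E (Suc i')"
        | A where "A \<subseteq> V - K" "card A = j * b" "\<not> has_clique A E (Suc j)"
        by auto
      then show ?thesis
      proof cases
        case 1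
        then have "finite A" "A \<inter> K = {}" using Suc.prems finite_subset by blast+
        then have "card (A \<union> K) = i * a" using 1 cl finK ij by (simp add: card_Un_disjoint)
        moreover have "\<not> has_indep (A \<union> K) E (Suc i)"
          using 1 cl has_indep_Un_clique ij by blast
        ultimately show ?thesis using 1 K(1) by (intro disjI1 exI[of _ "A \<union> K"]) auto
      qed auto
    next
      assume ind: "card K = b \<and> indep K E"
      have "((a + b) choose a) + i * a + j' * b \<le> card (V - K)"
        using Suc.prems ind cardVK ij by simp
      with Suc.hyps(1)[of i j' "V - K"] Suc.hyps(2) Suc.prems ij
      consider A where "A \<subseteq> V - K" "card A = i * a" "\<not> has_indep A E (Suc i)"
        | A where "A \<subseteq> V - K" "card A = j' * b" "\<not> has_clique A E (Suc j')"
        by auto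
      then show ?thesis
      proof cases
        case 2
        then have "finite A" "A \<inter> K = {}" using Suc.prems finite_subset by blast+
        then have "card (A \<union> K) = j * b" using 2 ind finK ij by (simp add: card_Un_disjoint)
        moreover have "\<not> has_clique (A \<union> K) E (Suc j)"
          using 2 ind has_clique_Un_indep ij by blast
        ultimately show ?thesis using 2 K(1) by (intro disjI2 exI[of _ "A \<union> K"]) auto
      qed auto
    qed
  qed
qed

lemma g_le_binomial:
  assumes "1 \<le> s" "1 \<le> t" "n \<le> (t - 1) * a" "n \<le> (s - 1) * b"
  shows "g n s t \<le> ((a + b) choose a) + (t - 1) * a + (s - 1) * b"
  unfolding g_def
proof (rule Least_le)
  have good: "\<exists>A\<in>[V]\<^bsup>n\<^esup>. \<not> (has_clique A E s \<and> has_indep A E t)"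
    if V: "finite V" "card V = ((a + b) choose a) + (t - 1) * a + (s - 1) * b"
    for V :: "nat set" and E
  proof -
    have st: "Suc (t - 1) = t" "Suc (s - 1) = s" using assms(1,2) by simp_all
    consider A where "A \<subseteq> V" "card A = (t - 1) * a" "\<not> has_indep A E t"
      | A where "A \<subseteq> V" "card A = (s - 1) * b" "\<not> has_clique A E s"
      using ex_union_of_cliques_or_indeps[of V a b "t - 1" "s - 1" E, unfolded st] V by auto
    then obtain A where A: "A \<subseteq> V" "n \<le> card A" "\<not> (has_clique A E s \<and> has_indep A E t)"
      using assms(3,4) by cases auto
    obtain A' where "A' \<subseteq> A" "card A' = n" "finite A'"
      using A(2) by (meson obtain_subset_with_card_n)
    then show ?thesis
      using A by (intro bexI[of _ A']) (auto simp: nsets_def dest: has_clique_mono has_indep_mono)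
  qed
  then show "all_graphs_have_good_set (((a + b) choose a) + (t - 1) * a + (s - 1) * b) n s t"
    unfolding all_graphs_have_good_set_def by blast
qed

text \<open>One term of the expansion of \<open>(x + 1) ^ (a + b)\<close> is at most the whole sum.
  It is applied with \<open>x = s / t\<close>, which balances \<open>a\<close> against
  \<open>b\<close>.\<close>

lemma choose_le_exp:
  fixes x :: real
  assumes "0 < x"
  shows "real ((a + b) choose a) \<le> exp (x * (a + b)) / x ^ a"
proof -
  have "real ((a + b) choose a) * x ^ a * 1 ^ (a + b - a) \<le> (\<Sum>k\<le>a + b. real ((a + b) choose k) * x ^ k * 1 ^ (a + b - k))"
    using assms by (intro member_le_sum) auto
  also have "\<dots> = (x + 1) ^ (a + b)" by (rule binomial_ring[symmetric])
  also have "\<dots> \<le> exp x ^ (a + b)"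
    using assms exp_ge_add_one_self[of x] by (intro power_mono) (auto simp: add.commute)
  also have "\<dots> = exp (x * (a + b))"
    by (simp add: exp_of_nat_mult[symmetric] mult.commute)
  finally show ?thesis using assms by (simp add: field_simps)
qed

lemma g_upper_bound:
  fixes n s t :: nat and l :: real
  defines "l \<equiv> log 2 (real n)"
  assumes st: "2 \<le> s" "s \<le> t" and t: "t \<le> l / (120 * log 2 l)"
    and l: "36 \<le> l" and nl: "l\<^sup>2 \<le> n"
  shows "real (g n s t) \<le> 2 powr (4 * real n / real t * log 2 (2 * exp 1 * real t / real s))"
proof -
  define u where "u = real t / real s"
  define z where "z = real n / real t"
  \<comment> \<open>The factor 2 makes up for \<open>t - 1 \<ge> t / 2\<close>, and likewise for
    \<open>s\<close> in \<open>b\<close>.\<close>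
  define a where "a = nat \<lceil>2 * real n / real t\<rceil>"
  define b where "b = nat \<lceil>2 * real n / real s\<rceil>"
  have t0: "0 < real t" "2 \<le> real t" and s0: "0 < real s" "2 \<le> real s" using st by auto
  have logl: "1 \<le> log 2 l" using l by (simp add: le_log_iff)
  have "real t * 1 \<le> t * (120 * log 2 l)" using logl by (intro mult_left_mono) auto
  also have "\<dots> \<le> l" using t logl by (simp add: field_simps)
  finally have tl: "real t \<le> l" by simp
  have "l * t \<le> l * l" using tl l by (intro mult_left_mono) auto
  then have zl: "l \<le> z" using nl t0 by (simp add: z_def field_simps power2_eq_square)
  have "l * 1 \<le> l * l" using l by (intro mult_left_mono) auto
  then have ln: "l \<le> n" using nl by (simp add: power2_eq_square)
  have n: "36 \<le> real n" using ln l by linarith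
  have u: "1 \<le> u" using st s0 by (simp add: u_def)
  have a: "2 * real n / t \<le> a" "a \<le> 2 * z + 1"
    unfolding a_def z_def by (auto simp: of_nat_nat)
  have b: "2 * real n / s \<le> b" "b \<le> 2 * real n / s + 1"
    unfolding b_def by (auto simp: of_nat_nat)
  have na: "n \<le> (t - 1) * a"
  proof -
    have "real n = real t / 2 * (2 * real n / t)" using t0 by simp
    also have "\<dots> \<le> (real t - 1) * a" using a t0 by (intro mult_mono) auto
    also have "\<dots> = real ((t - 1) * a)" using st by (simp add: of_nat_diff)
    finally show ?thesis by linarith
  qed
  have nb: "n \<le> (s - 1) * b"
  proof -
    have "real n = real s / 2 * (2 * real n / s)" using s0 by simp
    also have "\<dots> \<le> (real s - 1) * b" using b s0 by (intro mult_mono) auto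
    also have "\<dots> = real ((s - 1) * b)" using st by (simp add: of_nat_diff)
    finally show ?thesis by linarith
  qed
  have rest: "real ((t - 1) * a) + real ((s - 1) * b) \<le> 6 * n"
  proof -
    have "real ((t - 1) * a) \<le> t * (2 * z + 1)"
      using a unfolding of_nat_mult by (intro mult_mono) auto
    also have "\<dots> = 2 * n + t" using t0 by (simp add: z_def field_simps)
    finally have "real ((t - 1) * a) \<le> 2 * n + t" .
    moreover have "real ((s - 1) * b) \<le> s * (2 * real n / s + 1)"
      using b unfolding of_nat_mult by (intro mult_mono) auto
    moreover have "s * (2 * real n / s + 1) = 2 * n + s" using s0 by (simp add: field_simps)
    ultimately show ?thesis using tl ln st by simp
  qed
  \<comment> \<open>Up to rounding, \<open>a\<close> and \<open>b / u\<close> are both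
    \<open>2 * z\<close>, hence the exponent \<open>4 * z\<close>; rounding up costs
    \<open>exp 2\<close>.\<close>
  have "real ((a + b) choose a) \<le> exp (1 / u * (a + b)) / (1 / u) ^ a"
    using u by (intro choose_le_exp) auto
  also have "\<dots> = exp (1 / u * (a + b)) * u ^ a"
    by (simp add: power_one_over)
  also have "\<dots> \<le> exp (4 * z + 2) * u powr (4 * z)"
  proof (intro mult_mono)
    have "1 / u * b \<le> 1 / u * (2 * real n / s + 1)" using b u by (intro mult_left_mono) auto
    also have "\<dots> = 2 * z + 1 / u" using s0 t0 by (simp add: u_def z_def field_simps)
    also have "\<dots> \<le> 2 * z + 1" using u by simp
    finally have "1 / u * b \<le> 2 * z + 1" .
    moreover have "1 / u * a \<le> 1 * real a" using u by (intro mult_right_mono) auto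
    moreover have "1 / u * real (a + b) = 1 / u * a + 1 / u * b" by (simp only: of_nat_add distrib_left)
    ultimately show "exp (1 / u * real (a + b)) \<le> exp (4 * z + 2)" using a by simp
    have "u ^ a = u powr a" using u by (simp add: powr_realpow)
    also have "\<dots> \<le> u powr (4 * z)" using u a zl l by (intro powr_mono) auto
    finally show "u ^ a \<le> u powr (4 * z)" .
  qed (use u in auto)
  also have "\<dots> = exp (4 * z) * u powr (4 * z) * exp 2" by (simp add: exp_add)
  finally have choose: "real ((a + b) choose a) \<le> exp (4 * z) * u powr (4 * z) * exp 2" .
  have "1 * 1 \<le> exp (4 * z) * u powr (4 * z)"
    using zl l u by (intro mult_mono) (auto intro: ge_one_powr_ge_zero)
  then have one: "1 \<le> exp (4 * z) * u powr (4 * z)" by simp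
  have "exp (2::real) = exp 1 * exp 1" by (simp flip: exp_add)
  also have "\<dots> \<le> 3 * 3" using exp_le by (intro mult_mono) auto
  finally have e2: "exp (2::real) \<le> 9" by simp
  \<comment> \<open>As \<open>l \<le> z\<close>, the factor \<open>2 powr (4 * z)\<close> is at
    least \<open>n ^ 4\<close>. It absorbs \<open>exp 2\<close> and the additive
    \<open>6 * n\<close>, and it is the 2 in the base \<open>2 * exp 1 * u\<close>.\<close>
  have "real n = 2 powr l" using n by (simp add: l_def)
  then have "real n * real n * (real n * real n) = 2 powr (4 * l)" by (simp flip: powr_add)
  also have "\<dots> \<le> 2 powr (4 * z)" using zl by (intro powr_mono) auto
  finally have "real n * real n * (real n * real n) \<le> 2 powr (4 * z)" .
  moreover have nn: "36 * real n \<le> real n * real n" using n by (intro mult_right_mono) auto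
  moreover have "1 * (real n * real n) \<le> real n * real n * (real n * real n)"
  proof (rule mult_right_mono)
    show "1 \<le> real n * real n" using nn n by linarith
  qed simp
  ultimately have two: "exp 2 + 6 * real n \<le> 2 powr (4 * z)" using e2 n by linarith
  have "real (g n s t) \<le> real ((a + b) choose a) + (real ((t - 1) * a) + real ((s - 1) * b))"
    unfolding of_nat_add[symmetric] of_nat_le_iff
    using g_le_binomial[OF _ _ na nb] st by (simp add: add.assoc)
  also have "\<dots> \<le> exp (4 * z) * u powr (4 * z) * exp 2 + 1 * (6 * real n)"
    using choose rest by simp
  also have "\<dots> \<le> exp (4 * z) * u powr (4 * z) * exp 2 + exp (4 * z) * u powr (4 * z) * (6 * real n)"
    using one by (intro add_left_mono mult_right_mono) auto
  also have "\<dots> = exp (4 * z) * u powr (4 * z) * (exp 2 + 6 * real n)" by (simp add: distrib_left)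
  also have "\<dots> \<le> exp (4 * z) * u powr (4 * z) * 2 powr (4 * z)"
    using two by (intro mult_left_mono) auto
  also have "\<dots> = (2 * exp 1 * u) powr (4 * z)"
    using u by (simp add: powr_mult exp_powr_real)
  also have "\<dots> = 2 powr (4 * real n / real t * log 2 (2 * exp 1 * real t / real s))"
    using t0 s0 by (simp add: powr_def log_def u_def z_def)
  finally show ?thesis .
qed

theorem proposition1p2:
  shows "\<exists>n0::nat. \<forall>n \<ge> n0. \<forall>s t::nat.
    2 \<le> s \<longrightarrow> s \<le> t \<longrightarrow> real t \<le> log 2 (real n) / (120 * log 2 (log 2 (real n))) \<longrightarrow>
      2 powr (real n / (32 * real t) * log 2 (2 * exp 1 * real t / real s)) \<le> real (g n s t) \<and>
      real (g n s t) \<le> 2 powr (4 * real n / real t * log 2 (2 * exp 1 * real t / real s))"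
proof -
  have "\<forall>\<^sub>F n in sequentially. \<forall>s t::nat.
    2 \<le> s \<longrightarrow> s \<le> t \<longrightarrow> real t \<le> log 2 (real n) / (120 * log 2 (log 2 (real n))) \<longrightarrow>
      2 powr (real n / (32 * real t) * log 2 (2 * exp 1 * real t / real s)) \<le> real (g n s t) \<and>
      real (g n s t) \<le> 2 powr (4 * real n / real t * log 2 (2 * exp 1 * real t / real s))"
    using eventually_large
  proof eventually_elim
    case (elim n)
    note large = elim[unfolded Let_def]
    show ?case
    proof (intro allI impI)
      fix s t :: nat
      assume st: "2 \<le> s" "s \<le> t" "real t \<le> log 2 (real n) / (120 * log 2 (log 2 (real n)))"
      have "2 powr (real n / (32 * real t) * log 2 (2 * exp 1 * real t / real s)) \<le> real (g n s t)"
        by (rule g_lower_bound[OF st]; insert large; elim conjE; assumption)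
      moreover have "real (g n s t) \<le> 2 powr (4 * real n / real t * log 2 (2 * exp 1 * real t / real s))"
        by (rule g_upper_bound[OF st]; insert large; elim conjE; assumption)
      ultimately show "2 powr (real n / (32 * real t) * log 2 (2 * exp 1 * real t / real s)) \<le> real (g n s t) \<and>
        real (g n s t) \<le> 2 powr (4 * real n / real t * log 2 (2 * exp 1 * real t / real s))"
        by (rule conjI)
    qed
  qed
  then show ?thesis
    by (simp only: eventually_sequentially)
qed

end
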